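(* Let $(U,g)$ be a metric structure and $\tau$ a standard volume pseudoscalar field on $U$. For all $X\in\mathcal{M}(U)$, $$\tau(\partial_o\wedge X)=(-1)^{n+1}\,\partial_o\lrcorner(\tau X),$$ $$\tau\diamond_{g^{-1}}(\partial_o\wedge X)=\frac{(-1)^{n+1}}{\det[g]}\,\underline{g}\bigl(\partial_o\lrcorner(\tau X)\bigr),$$ where juxtaposition is the Euclidean Clifford product and $\diamond_{g^{-1}}$ is the $g^{-1}$-Clifford product.
   Context: $M$ is an $n$-dimensional smooth manifold, $(U_o,\phi_o)$ a chart with coordinates $x^1,\dots,x^n$, and $U\subset U_o$ open. The canonical space $\mathcal{U}_o$ is an $n$-dimensional real vector space with basis $b_1,\dots,b_n$ and the Euclidean scalar product $b_\mu\cdot b_\nu=\delta_{\mu\nu}$, extended to $\bigwedge\mathcal{U}_o$ by $(v_1\wedge\dots\wedge v_k)\cdot(w_1\wedge\dots\wedge w_k)=\det(v_i\cdot w_j)$, different grades being orthogonal. $\mathcal{M}(U)$ denotes the smooth maps $U\to\bigwedge\mathcal{U}_o$. $\widetilde X$ is reversion ($(-1)^{k(k-1)/2}$ on grade $k$); contractions: $(X\lrcorner Y)\cdot Z=Y\cdot(\widetilde X\wedge Z)$, $(X\llcorner Y)\cdot Z=X\cdot(Z\wedge\widetilde Y)$ for all $Z$. $\partial_o\lrcorner X=\sum_\mu b_\mu\lrcorner\partial X/\partial x^\mu$, $\partial_o\wedge X=\sum_\mu b_\mu\wedge\partial X/\partial x^\mu$. Metric structure $(U,g)$: $g$ is a smooth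 field of endomorphisms of $\mathcal{U}_o$, symmetric for the Euclidean product, with $\det[g]\ne0$ everywhere; $\underline g$ is its exterior-algebra extension. For a metric $m$ (Euclidean $m=\mathrm{id}$, or $m=g^{-1}$), the $m$-Clifford product is the associative bilinear product on multivectors for which scalars act by multiplication and, for vectors $b$, $bX=\underline m(b)\lrcorner X+b\wedge X$, $Xb=X\llcorner\underline m(b)+X\wedge b$. Standard volume pseudoscalar field: for a pair of reciprocal frame fields $(\{e_\mu\},\{e^\mu\})$ on $U$ ($e_\mu\cdot e^\nu=\delta_\mu^\nu$), $\tau=\sqrt{e_\wedge\cdot e_\wedge}\;e^\wedge$, where $e_\wedge=e_1\wedge\dots\wedge e_n$, $e^\wedge=e^1\wedge\dots\wedge e^n$ (so $\tau=\pm b_1\wedge\dots\wedge b_n$). *)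

theory Defs
  imports "HOL-Analysis.Analysis"
begin

section \<open>The exterior algebra of the canonical space\<close>

text \<open>
  The canonical space is \<open>real ^ 'n\<close> with the basis \<open>b\<^sub>\<mu> = axis \<mu> 1\<close>, indexed by a finite linearly
  ordered type with \<open>n = CARD('n)\<close> elements. A multivector is given by its coefficients
  in the basis \<open>b\<^sub>I = b\<^bsub>i1\<^esub> \<and> \<dots> \<and> b\<^bsub>ik\<^esub>\<close> with \<open>I = {i1 < \<dots> < ik}\<close>. Since \<open>b\<^sub>I \<bullet> b\<^sub>J = det (b\<^sub>i \<bullet> b\<^sub>j)\<close>
  is 1 if \<open>I = J\<close> and 0 otherwise, the scalar product of multivectors is the inner product of
  the Euclidean space \<open>real ^ ('n set)\<close>.
\<close>

type_synonym 'n canonical = "(real, 'n) vec"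
type_synonym 'n multivector = "(real, 'n set) vec"

definition blade :: "'n::{finite,linorder} set \<Rightarrow> 'n multivector" where
  "blade I = axis I 1"

definition mv_scalar :: "real \<Rightarrow> 'n::{finite,linorder} multivector" where
  "mv_scalar a = a *\<^sub>R blade {}"

definition mv_vec :: "'n canonical \<Rightarrow> 'n::{finite,linorder} multivector" where
  "mv_vec v = (\<Sum>i\<in>UNIV. (v $ i) *\<^sub>R blade {i})"

text \<open>For disjoint \<open>I\<close>, \<open>J\<close> this is the sign of the permutation that sorts \<open>I\<close> followed by \<open>J\<close>.\<close>

definition blade_sign :: "'n::{finite,linorder} set \<Rightarrow> 'n set \<Rightarrow> real" where
  "blade_sign I J = (-1) ^ card {(i, j). i \<in> I \<and> j \<in> J \<and> j < i}"

definition wedge :: "'n::{finite,linorder} multivector \<Rightarrow> 'n multivector \<Rightarrow> 'n multivector"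
    (infixr "\<and>\<^sub>m" 70) where
  "X \<and>\<^sub>m Y = (\<chi> K. \<Sum>I\<in>Pow K. blade_sign I (K - I) * X $ I * Y $ (K - I))"

definition wedge_list :: "'n::{finite,linorder} multivector list \<Rightarrow> 'n multivector" where
  "wedge_list Xs = foldr wedge Xs (mv_scalar 1)"

definition reversion :: "'n::{finite,linorder} multivector \<Rightarrow> 'n multivector" where
  "reversion X = (\<chi> I. (-1) ^ (card I * (card I - 1) div 2) * X $ I)"

definition lcontr :: "'n::{finite,linorder} multivector \<Rightarrow> 'n multivector \<Rightarrow> 'n multivector" where
  "lcontr X = adjoint (\<lambda>Z. reversion X \<and>\<^sub>m Z)"

definition rcontr :: "'n::{finite,linorder} multivector \<Rightarrow> 'n multivector \<Rightarrow> 'n multivector" where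
  "rcontr X Y = adjoint (\<lambda>Z. Z \<and>\<^sub>m reversion Y) X"

definition wedge_family :: "('n \<Rightarrow> 'n canonical) \<Rightarrow> 'n::{finite,linorder} set \<Rightarrow> 'n multivector" where
  "wedge_family v I = wedge_list (map (\<lambda>i. mv_vec (v i)) (sorted_list_of_set I))"

definition outermorphism ::
    "('n canonical \<Rightarrow> 'n canonical) \<Rightarrow> 'n::{finite,linorder} multivector \<Rightarrow> 'n multivector" where
  "outermorphism f X = (\<Sum>I\<in>UNIV. (X $ I) *\<^sub>R wedge_family (\<lambda>i. f (axis i 1)) I)"

section \<open>Clifford products\<close>

definition is_clifford_product :: "('n canonical \<Rightarrow> 'n canonical) \<Rightarrow>
    ('n::{finite,linorder} multivector \<Rightarrow> 'n multivector \<Rightarrow> 'n multivector) \<Rightarrow> bool" where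
  "is_clifford_product m P \<longleftrightarrow>
     bilinear P \<and>
     (\<forall>X Y Z. P (P X Y) Z = P X (P Y Z)) \<and>
     (\<forall>a X. P (mv_scalar a) X = a *\<^sub>R X \<and> P X (mv_scalar a) = a *\<^sub>R X) \<and>
     (\<forall>b X. P (mv_vec b) X = lcontr (mv_vec (m b)) X + mv_vec b \<and>\<^sub>m X) \<and>
     (\<forall>b X. P X (mv_vec b) = rcontr X (mv_vec (m b)) + X \<and>\<^sub>m mv_vec b)"

text \<open>There is exactly one such product if \<open>m\<close> is linear and symmetric, see \<open>clifford_product_ex1\<close>.\<close>

definition clifford_product :: "('n canonical \<Rightarrow> 'n canonical) \<Rightarrow>
    'n::{finite,linorder} multivector \<Rightarrow> 'n multivector \<Rightarrow> 'n multivector" where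
  "clifford_product m = (THE P. is_clifford_product m P)"

section \<open>Smooth fields on a manifold\<close>

primrec times_differentiable_on ::
    "nat \<Rightarrow> 'a::euclidean_space set \<Rightarrow> ('a \<Rightarrow> 'b::real_normed_vector) \<Rightarrow> bool" where
  "times_differentiable_on 0 S f \<longleftrightarrow> continuous_on S f"
| "times_differentiable_on (Suc k) S f \<longleftrightarrow>
     (\<forall>x\<in>S. f differentiable (at x)) \<and>
     (\<forall>v. times_differentiable_on k S (\<lambda>x. frechet_derivative f (at x) v))"

definition smooth_on :: "'a::euclidean_space set \<Rightarrow> ('a \<Rightarrow> 'b::real_normed_vector) \<Rightarrow> bool" where
  "smooth_on S f \<longleftrightarrow> (\<forall>k. times_differentiable_on k S f)"

text \<open>Charts are total functions; only their values on the chart domain are meaningful.\<close>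

type_synonym ('p, 'n) chart = "'p set \<times> ('p \<Rightarrow> 'n canonical)"

fun is_chart :: "'p topology \<Rightarrow> ('p, 'n::{finite,linorder}) chart \<Rightarrow> bool" where
  "is_chart M (W, \<psi>) \<longleftrightarrow> openin M W \<and> open (\<psi> ` W) \<and>
     homeomorphic_map (subtopology M W) (top_of_set (\<psi> ` W)) \<psi>"

fun compatible :: "('p, 'n::{finite,linorder}) chart \<Rightarrow> ('p, 'n) chart \<Rightarrow> bool" where
  "compatible (W, \<psi>) (V, \<eta>) \<longleftrightarrow>
     smooth_on (\<psi> ` (W \<inter> V)) (\<eta> \<circ> inv_into W \<psi>) \<and>
     smooth_on (\<eta> ` (W \<inter> V)) (\<psi> \<circ> inv_into V \<eta>)"

definition smooth_manifold :: "'p topology \<Rightarrow> ('p, 'n::{finite,linorder}) chart set \<Rightarrow> bool" where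
  "smooth_manifold M A \<longleftrightarrow>
     Hausdorff_space M \<and> second_countable M \<and>
     (\<forall>c\<in>A. is_chart M c) \<and> (\<Union>c\<in>A. fst c) = topspace M \<and>
     (\<forall>c\<in>A. \<forall>d\<in>A. compatible c d) \<and>
     (\<forall>c. is_chart M c \<and> (\<forall>d\<in>A. compatible c d) \<longrightarrow> c \<in> A)"

definition smooth_field ::
    "('p, 'n::{finite,linorder}) chart set \<Rightarrow> 'p set \<Rightarrow> ('p \<Rightarrow> 'b::real_normed_vector) \<Rightarrow> bool" where
  "smooth_field A U F \<longleftrightarrow> (\<forall>(W, \<psi>)\<in>A. smooth_on (\<psi> ` (W \<inter> U)) (F \<circ> inv_into W \<psi>))"

definition multivector_fields ::
    "('p, 'n::{finite,linorder}) chart set \<Rightarrow> 'p set \<Rightarrow> ('p \<Rightarrow> 'n multivector) set" where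
  "multivector_fields A U = {X. smooth_field A U X}"

text \<open>
  \<open>div_deriv\<close> is the operator \<open>\<partial>\<^sub>o\<lrcorner>\<close> and \<open>curl_deriv\<close> is \<open>\<partial>\<^sub>o\<and>\<close>, both taken in the given chart.
\<close>

fun coord_deriv ::
    "('p, 'n::{finite,linorder}) chart \<Rightarrow> 'n \<Rightarrow> ('p \<Rightarrow> 'n multivector) \<Rightarrow> 'p \<Rightarrow> 'n multivector" where
  "coord_deriv (W, \<psi>) \<mu> X p =
     frechet_derivative (X \<circ> inv_into W \<psi>) (at (\<psi> p)) (axis \<mu> 1)"

definition div_deriv ::
    "('p, 'n::{finite,linorder}) chart \<Rightarrow> ('p \<Rightarrow> 'n multivector) \<Rightarrow> 'p \<Rightarrow> 'n multivector" where
  "div_deriv c X p = (\<Sum>\<mu>\<in>UNIV. lcontr (mv_vec (axis \<mu> 1)) (coord_deriv c \<mu> X p))"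

definition curl_deriv ::
    "('p, 'n::{finite,linorder}) chart \<Rightarrow> ('p \<Rightarrow> 'n multivector) \<Rightarrow> 'p \<Rightarrow> 'n multivector" where
  "curl_deriv c X p = (\<Sum>\<mu>\<in>UNIV. mv_vec (axis \<mu> 1) \<and>\<^sub>m coord_deriv c \<mu> X p)"

definition metric_structure :: "('p, 'n::{finite,linorder}) chart set \<Rightarrow> 'p set \<Rightarrow>
    ('p \<Rightarrow> 'n canonical \<Rightarrow>\<^sub>L 'n canonical) \<Rightarrow> bool" where
  "metric_structure A U g \<longleftrightarrow> smooth_field A U g \<and>
     (\<forall>p\<in>U. (\<forall>v w. g p v \<bullet> w = v \<bullet> g p w) \<and> det (matrix (g p)) \<noteq> 0)"

definition reciprocal_frame_fields :: "('p, 'n::{finite,linorder}) chart set \<Rightarrow> 'p set \<Rightarrow>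
    ('n \<Rightarrow> 'p \<Rightarrow> 'n canonical) \<Rightarrow> ('n \<Rightarrow> 'p \<Rightarrow> 'n canonical) \<Rightarrow> bool" where
  "reciprocal_frame_fields A U e e' \<longleftrightarrow>
     (\<forall>\<mu>. smooth_field A U (e \<mu>) \<and> smooth_field A U (e' \<mu>)) \<and>
     (\<forall>p\<in>U. \<forall>\<mu> \<nu>. e \<mu> p \<bullet> e' \<nu> p = (if \<mu> = \<nu> then 1 else 0))"

definition standard_volume_field ::
    "('p, 'n::{finite,linorder}) chart set \<Rightarrow> 'p set \<Rightarrow> ('p \<Rightarrow> 'n multivector) \<Rightarrow> bool" where
  "standard_volume_field A U \<tau> \<longleftrightarrow>
     (\<exists>e e'. reciprocal_frame_fields A U e e' \<and>
       (\<forall>p\<in>U. \<tau> p =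
          sqrt (wedge_family (\<lambda>\<mu>. e \<mu> p) UNIV \<bullet> wedge_family (\<lambda>\<mu>. e \<mu> p) UNIV) *\<^sub>R
            wedge_family (\<lambda>\<mu>. e' \<mu> p) UNIV))"

section \<open>Well-definedness of the algebraic notions\<close>

lemma mv_expand: "(X :: 'n::{finite,linorder} multivector) = (\<Sum>I\<in>UNIV. (X $ I) *\<^sub>R blade I)"
  by (simp add: vec_eq_iff blade_def axis_def if_distrib cong: if_cong)

lemma linear_eq_blade:
  assumes "linear f" "linear g" "\<And>I::'n::{finite,linorder} set. f (blade I) = g (blade I)"
  shows "f = g"
proof
  fix X show "f X = g X"
    by (subst (1 2) mv_expand) (simp add: linear_sum[OF assms(1)] linear_sum[OF assms(2)]
      linear_scale[OF assms(1)] linear_scale[OF assms(2)] assms(3))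
qed

lemma inner_blade: "blade I \<bullet> (X :: 'n::{finite,linorder} multivector) = X $ I"
  by (simp add: blade_def inner_axis')

lemma mv_vec_axis: "mv_vec (axis i 1) = blade {i}"
proof -
  have "axis i (1::real) $ j *\<^sub>R blade {j} = (if j = i then blade {j} else 0)" for j
    by (auto simp: axis_def)
  then show ?thesis unfolding mv_vec_def by simp
qed

lemma linear_mv_vec: "linear mv_vec"
  by (rule linearI) (auto simp: mv_vec_def algebra_simps sum.distrib scaleR_sum_right)

lemma wedge_bilinear: "bilinear wedge"
  unfolding bilinear_def
  by (auto intro!: linearI simp: wedge_def vec_eq_iff algebra_simps sum.distrib sum_distrib_left)

lemma wedge_linear: "linear (wedge X)" "linear (\<lambda>X. wedge X Y)"
  using wedge_bilinear unfolding bilinear_def by blast+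

lemma wedge_blade:
  "blade I \<and>\<^sub>m blade J = (if I \<inter> J = {} then blade_sign I J *\<^sub>R blade (I \<union> J) else 0)"
proof -
  have "(blade I \<and>\<^sub>m blade J) $ K = (if I \<inter> J = {} \<and> K = I \<union> J then blade_sign I J else 0)" for K
  proof -
    have "(blade I \<and>\<^sub>m blade J) $ K =
        (\<Sum>L\<in>Pow K. if L = I then (if K - I = J then blade_sign I J else 0) else 0)"
      unfolding wedge_def vec_lambda_beta
      by (rule sum.cong) (auto simp: blade_def axis_def)
    also have "\<dots> = (if I \<subseteq> K \<and> K - I = J then blade_sign I J else 0)"
      by (simp add: sum.delta)
    also have "I \<subseteq> K \<and> K - I = J \<longleftrightarrow> I \<inter> J = {} \<and> K = I \<union> J" by auto
    finally show ?thesis .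
  qed
  then show ?thesis by (auto simp: vec_eq_iff blade_def axis_def)
qed

lemma blade_sign_Un1:
  assumes "I \<inter> J = {}" shows "blade_sign (I \<union> J) K = blade_sign I K * blade_sign J K"
proof -
  have "{(i, j). i \<in> I \<union> J \<and> j \<in> K \<and> j < i} =
      {(i, j). i \<in> I \<and> j \<in> K \<and> j < i} \<union> {(i, j). i \<in> J \<and> j \<in> K \<and> j < i}" by auto
  then show ?thesis using assms unfolding blade_sign_def
    by (auto simp: power_add[symmetric] intro!: arg_cong[where f="(^) (-1)"] card_Un_disjoint)
qed

lemma blade_sign_Un2:
  assumes "J \<inter> K = {}" shows "blade_sign I (J \<union> K) = blade_sign I J * blade_sign I K"
proof -
  have "{(i, j). i \<in> I \<and> j \<in> J \<union> K \<and> j < i} =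
      {(i, j). i \<in> I \<and> j \<in> J \<and> j < i} \<union> {(i, j). i \<in> I \<and> j \<in> K \<and> j < i}" by auto
  then show ?thesis using assms unfolding blade_sign_def
    by (auto simp: power_add[symmetric] intro!: arg_cong[where f="(^) (-1)"] card_Un_disjoint)
qed

lemma blade_sign_square: "blade_sign I J * blade_sign I J = 1"
  by (simp add: blade_sign_def power_mult_distrib[symmetric])

lemma blade_sign_swap:
  assumes "i \<notin> I" shows "blade_sign {i} I * blade_sign I {i} = (-1) ^ card I"
proof -
  have 1: "{(a, j). a \<in> {i} \<and> j \<in> I \<and> j < a} = Pair i ` {j \<in> I. j < i}" by auto
  have 2: "{(a, j). a \<in> I \<and> j \<in> {i} \<and> j < a} = (\<lambda>a. (a, i)) ` {j \<in> I. i < j}" by auto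
  have "card {j \<in> I. j < i} + card {j \<in> I. i < j} = card ({j \<in> I. j < i} \<union> {j \<in> I. i < j})"
    by (rule card_Un_disjoint[symmetric]) auto
  also have "{j \<in> I. j < i} \<union> {j \<in> I. i < j} = I" using assms by (auto simp: not_less le_less)
  finally show ?thesis unfolding blade_sign_def 1 2
    by (simp add: card_image inj_on_def power_add[symmetric])
qed

lemma wedge_scaleR: "wedge (a *\<^sub>R X) Y = a *\<^sub>R wedge X Y" "wedge X (a *\<^sub>R Y) = a *\<^sub>R wedge X Y"
  using linear_scale[OF wedge_linear(1)] linear_scale[OF wedge_linear(2)] by auto

lemma wedge_zero: "wedge 0 Y = 0" "wedge X 0 = 0"
  using linear_0[OF wedge_linear(1)] linear_0[OF wedge_linear(2)] by auto

lemma wedge_add: "wedge (X + X') Y = wedge X Y + wedge X' Y" "wedge X (Y + Y') = wedge X Y + wedge X Y'"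
  using linear_add[OF wedge_linear(1)] linear_add[OF wedge_linear(2)] by auto

lemma trilinear_eq_blade:
  fixes P Q :: "'n::{finite,linorder} multivector \<Rightarrow> 'n multivector \<Rightarrow> 'n multivector \<Rightarrow> 'n multivector"
  assumes "\<And>Y Z. linear (\<lambda>X. P X Y Z)" "\<And>X Z. linear (\<lambda>Y. P X Y Z)" "\<And>X Y. linear (P X Y)"
    and "\<And>Y Z. linear (\<lambda>X. Q X Y Z)" "\<And>X Z. linear (\<lambda>Y. Q X Y Z)" "\<And>X Y. linear (Q X Y)"
    and "\<And>I J K. P (blade I) (blade J) (blade K) = Q (blade I) (blade J) (blade K)"
  shows "P X Y Z = Q X Y Z"
proof -
  have 1: "P (blade I) (blade J) = Q (blade I) (blade J)" for I J
    using assms by (intro linear_eq_blade) auto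
  have 2: "(\<lambda>Y. P (blade I) Y Z) = (\<lambda>Y. Q (blade I) Y Z)" for I Z
    using assms 1 by (intro linear_eq_blade) auto
  have 3: "(\<lambda>X. P X Y Z) = (\<lambda>X. Q X Y Z)" for Y Z
    using assms fun_cong[OF 2] by (intro linear_eq_blade) auto
  show ?thesis using fun_cong[OF 3] .
qed

lemma wedge_assoc: "wedge (wedge X Y) Z = wedge X (wedge Y Z)"
proof (rule trilinear_eq_blade[where P="\<lambda>X Y Z. wedge (wedge X Y) Z"])
  fix I J K :: "'n::{finite,linorder} set"
  show "wedge (wedge (blade I) (blade J)) (blade K) = wedge (blade I) (wedge (blade J) (blade K))"
    by (auto simp: wedge_blade wedge_scaleR wedge_zero blade_sign_Un1 blade_sign_Un2 Un_assoc
        Int_Un_distrib Int_Un_distrib2)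
qed (auto intro!: linearI simp: wedge_add wedge_scaleR)

lemma wedge_scalar:
  fixes X :: "'n::{finite,linorder} multivector"
  shows "wedge (mv_scalar a) X = a *\<^sub>R X" "wedge X (mv_scalar a) = a *\<^sub>R X"
proof -
  have s: "blade_sign {} K = 1" "blade_sign K {} = 1" for K :: "'n set"
    by (auto simp: blade_sign_def)
  have "wedge (mv_scalar a) = (\<lambda>X :: 'n multivector. a *\<^sub>R X)"
    "(\<lambda>X :: 'n multivector. wedge X (mv_scalar a)) = (\<lambda>X. a *\<^sub>R X)"
    by (intro linear_eq_blade;
        auto intro!: linearI simp: wedge_add wedge_scaleR algebra_simps mv_scalar_def wedge_blade s)+
  then show "wedge (mv_scalar a) X = a *\<^sub>R X" "wedge X (mv_scalar a) = a *\<^sub>R X"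
    by (auto dest: fun_cong)
qed

lemma wedge_vec_anticomm:
  fixes v w :: "'n::{finite,linorder} canonical"
  shows "mv_vec v \<and>\<^sub>m mv_vec w = - (mv_vec w \<and>\<^sub>m mv_vec v)"
proof -
  have *: "blade {i} \<and>\<^sub>m blade {j} = - (blade {j} \<and>\<^sub>m blade {i})" for i j :: 'n
  proof (cases "i = j")
    case False
    then have "blade_sign {i} {j} * blade_sign {j} {i} = - 1"
      using blade_sign_swap[of i "{j}"] by simp
    then have "blade_sign {i} {j} = - blade_sign {j} {i}"
      using blade_sign_square[of "{j}" "{i}"] by (smt (verit) mult_cancel_right mult_minus_left)
    with False show ?thesis by (auto simp: wedge_blade insert_commute)
  qed (simp add: wedge_blade)
  have "mv_vec v \<and>\<^sub>m mv_vec w = (\<Sum>i\<in>UNIV. \<Sum>j\<in>UNIV. (v $ i * w $ j) *\<^sub>R (blade {i} \<and>\<^sub>m blade {j}))"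
    unfolding mv_vec_def by (simp add: linear_sum[OF wedge_linear(1)] linear_sum[OF wedge_linear(2)]
      wedge_scaleR scaleR_sum_right, subst sum.swap, simp add: mult.commute)
  also have "\<dots> = (\<Sum>i\<in>UNIV. \<Sum>j\<in>UNIV. - ((w $ j * v $ i) *\<^sub>R (blade {j} \<and>\<^sub>m blade {i})))"
  proof (intro sum.cong refl)
    show "(v $ i * w $ j) *\<^sub>R (blade {i} \<and>\<^sub>m blade {j}) = - ((w $ j * v $ i) *\<^sub>R (blade {j} \<and>\<^sub>m blade {i}))" for i j
      by (subst *) (simp add: mult.commute)
  qed
  also have "\<dots> = - (mv_vec w \<and>\<^sub>m mv_vec v)"
    unfolding mv_vec_def by (simp add: linear_sum[OF wedge_linear(1)] linear_sum[OF wedge_linear(2)]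
      wedge_scaleR scaleR_sum_right sum_negf) (simp add: mult.commute)
  finally show ?thesis .
qed

lemma linear_eq_axis:
  fixes f g :: "'n::{finite,linorder} canonical \<Rightarrow> 'n multivector"
  assumes "linear f" "linear g" "\<And>i. f (axis i 1) = g (axis i 1)"
  shows "f = g"
proof (rule linear_eq_stdbasis[OF assms(1,2)])
  fix b :: "'n canonical" assume "b \<in> Basis"
  then show "f b = g b" using assms(3) by (auto simp: Basis_vec_def)
qed

lemma wedge_vec_self: "mv_vec v \<and>\<^sub>m mv_vec v = 0"
proof -
  have "2 *\<^sub>R (mv_vec v \<and>\<^sub>m mv_vec v) = 0"
    using wedge_vec_anticomm[of v v] by (simp add: scaleR_2 add_eq_0_iff)
  then show ?thesis by simp
qed

lemma wedge_family_empty: "wedge_family v {} = mv_scalar 1"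
  by (simp add: wedge_family_def wedge_list_def)

lemma wedge_family_Min:
  assumes "I \<noteq> {}"
  shows "wedge_family v I = mv_vec (v (Min I)) \<and>\<^sub>m wedge_family v (I - {Min I})"
  using assms by (simp add: wedge_family_def wedge_list_def sorted_list_of_set_nonempty)

lemma wedge_family_insert_less:
  assumes "\<And>j. j \<in> I \<Longrightarrow> i < j"
  shows "wedge_family v (insert i I) = mv_vec (v i) \<and>\<^sub>m wedge_family v I"
proof -
  have "Min (insert i I) = i" using assms by (intro Min_eqI) (auto intro: less_imp_le)
  moreover have "insert i I - {i} = I" using assms by auto
  ultimately show ?thesis using wedge_family_Min[of "insert i I" v] by simp
qed

lemma blade_sign_less:
  assumes "\<And>j. j \<in> I \<Longrightarrow> i < j" shows "blade_sign {i} I = 1"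
proof -
  have "{(a, j). a \<in> {i} \<and> j \<in> I \<and> j < a} = {}" using assms by (auto dest: less_asym)
  then show ?thesis by (simp only: blade_sign_def) simp
qed

lemma wedge_vec_family:
  "mv_vec (v i) \<and>\<^sub>m wedge_family v J =
    (if i \<in> J then 0 else blade_sign {i} J *\<^sub>R wedge_family v (insert i J))"
proof (induction "card J" arbitrary: J rule: less_induct)
  case less
  show ?case
  proof (cases "\<forall>j\<in>J. i < j")
    case True
    then show ?thesis by (auto simp: wedge_family_insert_less blade_sign_less)
  next
    case False
    then have ne: "J \<noteq> {}" by auto
    define m where "m = Min J"
    define J' where "J' = J - {m}"
    have m: "m \<in> J" "\<And>j. j \<in> J' \<Longrightarrow> m < j"
      using ne by (auto simp: m_def J'_def order.strict_iff_order)
    have J: "J = insert m J'" "m \<notin> J'" using m by (auto simp: J'_def)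
    have F: "wedge_family v J = mv_vec (v m) \<and>\<^sub>m wedge_family v J'"
      using wedge_family_Min[OF ne] by (simp add: m_def J'_def)
    show ?thesis
    proof (cases "i = m")
      case True
      then show ?thesis using m(1) by (simp add: F wedge_assoc[symmetric] wedge_vec_self wedge_zero)
    next
      case im: False
      have "m < i" using False m im J by (metis insert_iff less_trans linorder_neqE)
      have "{(a, j). a \<in> {i} \<and> j \<in> {m} \<and> j < a} = {(i, m)}" using \<open>m < i\<close> by auto
      then have "blade_sign {i} {m} = -1" by (simp only: blade_sign_def) simp
      then have s: "blade_sign {i} J = - blade_sign {i} J'"
        using blade_sign_Un2[of "{m}" J' "{i}"] J by simp
      have c: "card J' < card J" using J by simp
      have "mv_vec (v i) \<and>\<^sub>m wedge_family v J = - (mv_vec (v m) \<and>\<^sub>m (mv_vec (v i) \<and>\<^sub>m wedge_family v J'))"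
        unfolding F wedge_assoc[symmetric] by (subst wedge_vec_anticomm)
          (metis linear_neg[OF wedge_linear(2)])
      moreover have "wedge_family v (insert i J) = mv_vec (v m) \<and>\<^sub>m wedge_family v (insert i J')"
        unfolding J(1) insert_commute[of i m] using \<open>m < i\<close> m by (intro wedge_family_insert_less) auto
      moreover have "i \<in> J \<longleftrightarrow> i \<in> J'" using im J by auto
      ultimately show ?thesis using less[OF c] by (simp add: s wedge_zero wedge_scaleR)
    qed
  qed
qed

lemma wedge_family_family:
  "wedge_family v I \<and>\<^sub>m wedge_family v J =
    (if I \<inter> J = {} then blade_sign I J *\<^sub>R wedge_family v (I \<union> J) else 0)"
proof (induction "card I" arbitrary: I rule: less_induct)
  case less
  show ?case
  proof (cases "I = {}")
    case True then show ?thesis by (simp add: wedge_family_empty wedge_scalar blade_sign_def)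
  next
    case ne: False
    define m where "m = Min I"
    define I' where "I' = I - {m}"
    have m: "m \<in> I" "\<And>j. j \<in> I' \<Longrightarrow> m < j"
      using ne by (auto simp: m_def I'_def order.strict_iff_order)
    have I: "I = insert m I'" "m \<notin> I'" using m by (auto simp: I'_def)
    have "card I' < card I" using I by simp
    note IH = less[OF this]
    have F: "wedge_family v I = mv_vec (v m) \<and>\<^sub>m wedge_family v I'"
      using wedge_family_Min[OF ne] by (simp add: m_def I'_def)
    show ?thesis
    proof (cases "I' \<inter> J = {}")
      case False
      then have "I \<inter> J \<noteq> {}" by (auto simp: I(1))
      with False show ?thesis by (simp add: F wedge_assoc IH wedge_zero)
    next
      case True
      have "blade_sign I J = blade_sign {m} J * blade_sign I' J"
        using blade_sign_Un1[of "{m}" I' J] I by simp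
      moreover have "blade_sign {m} (I' \<union> J) = blade_sign {m} J"
        using blade_sign_Un2[OF True, of "{m}"] m(2) by (simp add: blade_sign_less)
      moreover have "wedge_family v I \<and>\<^sub>m wedge_family v J =
          blade_sign I' J *\<^sub>R (mv_vec (v m) \<and>\<^sub>m wedge_family v (I' \<union> J))"
        using True by (simp add: F wedge_assoc IH wedge_scaleR)
      moreover have "I \<inter> J = {} \<longleftrightarrow> m \<notin> I' \<union> J" "I \<union> J = insert m (I' \<union> J)" using True I by auto
      ultimately show ?thesis by (simp add: wedge_vec_family mult.commute)
    qed
  qed
qed

lemma wedge_family_axis: "wedge_family (\<lambda>i. axis i 1) I = blade I"
proof (induction "card I" arbitrary: I rule: less_induct)
  case less
  show ?case
  proof (cases "I = {}")
    case True then show ?thesis by (simp add: wedge_family_empty mv_scalar_def)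
  next
    case ne: False
    then have "Min I \<in> I" "\<And>j. j \<in> I - {Min I} \<Longrightarrow> Min I < j"
      by (auto simp: order.strict_iff_order)
    moreover from this(1) have "card (I - {Min I}) < card I" by (intro card_Diff1_less) simp_all
    note less[OF this]
    moreover have "blade_sign {Min I} (I - {Min I}) = 1" using calculation by (intro blade_sign_less)
    ultimately show ?thesis
      by (simp add: wedge_family_Min[OF ne] mv_vec_axis wedge_blade insert_absorb)
  qed
qed

lemma outermorphism_blade: "outermorphism f (blade I) = wedge_family (\<lambda>i. f (axis i 1)) I"
proof -
  have "blade I $ J *\<^sub>R wedge_family (\<lambda>i. f (axis i 1)) J =
      (if J = I then wedge_family (\<lambda>i. f (axis i 1)) J else 0)" for J
    by (auto simp: blade_def axis_def)
  then show ?thesis by (simp add: outermorphism_def)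
qed

lemma linear_outermorphism: "linear (outermorphism f)"
  by (rule linearI) (auto simp: outermorphism_def algebra_simps sum.distrib scaleR_sum_right)

lemma outermorphism_scalar: "outermorphism f (mv_scalar a) = mv_scalar a"
  by (simp add: mv_scalar_def linear_scale[OF linear_outermorphism] outermorphism_blade
      wedge_family_empty)

lemma outermorphism_vec:
  fixes f :: "'n::{finite,linorder} canonical \<Rightarrow> 'n canonical"
  assumes "linear f" shows "outermorphism f (mv_vec v) = mv_vec (f v)"
proof -
  have "(\<lambda>v. outermorphism f (mv_vec v)) = (\<lambda>v. mv_vec (f v))"
  proof (rule linear_eq_axis)
    show "linear (\<lambda>v. outermorphism f (mv_vec v))"
      using linear_compose[OF linear_mv_vec linear_outermorphism] by (simp add: o_def)
    show "linear (\<lambda>v. mv_vec (f v))"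
      using linear_compose[OF assms linear_mv_vec] by (simp add: o_def)
    show "outermorphism f (mv_vec (axis i 1)) = mv_vec (f (axis i 1))" for i
      by (simp add: mv_vec_axis outermorphism_blade wedge_family_def wedge_list_def wedge_scalar)
  qed
  then show ?thesis by (rule fun_cong)
qed

lemma outermorphism_wedge: "outermorphism f (X \<and>\<^sub>m Y) = outermorphism f X \<and>\<^sub>m outermorphism f Y"
proof -
  have "outermorphism f (blade I \<and>\<^sub>m blade J) = outermorphism f (blade I) \<and>\<^sub>m outermorphism f (blade J)" for I J
    by (simp add: wedge_blade outermorphism_blade wedge_family_family
        linear_scale[OF linear_outermorphism] linear_0[OF linear_outermorphism])
  then have 1: "(\<lambda>Y. outermorphism f (blade I \<and>\<^sub>m Y)) = (\<lambda>Y. outermorphism f (blade I) \<and>\<^sub>m outermorphism f Y)" for I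
    by (intro linear_eq_blade) (auto intro!: linearI simp: wedge_add wedge_scaleR
        linear_scale[OF linear_outermorphism] linear_add[OF linear_outermorphism])
  have "(\<lambda>X. outermorphism f (X \<and>\<^sub>m Y)) = (\<lambda>X. outermorphism f X \<and>\<^sub>m outermorphism f Y)"
    by (intro linear_eq_blade) (auto intro!: linearI simp: wedge_add wedge_scaleR fun_cong[OF 1]
        linear_scale[OF linear_outermorphism] linear_add[OF linear_outermorphism])
  then show ?thesis by (rule fun_cong)
qed

lemma lcontr_inner: "lcontr X Y \<bullet> Z = Y \<bullet> (reversion X \<and>\<^sub>m Z)"
  unfolding lcontr_def using adjoint_works[OF wedge_linear(1)] by (metis inner_commute)

lemma rcontr_inner: "rcontr X Y \<bullet> Z = X \<bullet> (Z \<and>\<^sub>m reversion Y)"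
  unfolding rcontr_def using adjoint_works[OF wedge_linear(2)] by (metis inner_commute)


lemma reversion_blade: "reversion (blade I) = (-1) ^ (card I * (card I - 1) div 2) *\<^sub>R blade I"
  by (auto simp: reversion_def blade_def vec_eq_iff axis_def)

lemma linear_reversion: "linear reversion"
  by (rule linearI) (auto simp: reversion_def vec_eq_iff algebra_simps)

lemma reversion_mv_vec: "reversion (mv_vec v) = mv_vec v"
  unfolding mv_vec_def
  by (simp add: linear_sum[OF linear_reversion] linear_scale[OF linear_reversion] reversion_blade)

lemma linear_lcontr: "linear (lcontr X)"
  unfolding lcontr_def by (rule adjoint_linear[OF wedge_linear(1)])

lemma linear_lcontr1: "linear (\<lambda>X. lcontr X Y)"
proof (rule linearI)
  fix X X' :: "'a multivector" and a :: real
  show "lcontr (X + X') Y = lcontr X Y + lcontr X' Y"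
    by (subst vector_eq_rdot[symmetric])
      (simp add: lcontr_inner inner_simps linear_add[OF linear_reversion] wedge_add)
  show "lcontr (a *\<^sub>R X) Y = a *\<^sub>R lcontr X Y"
    by (subst vector_eq_rdot[symmetric])
      (simp add: lcontr_inner inner_simps linear_scale[OF linear_reversion] wedge_scaleR)
qed

lemma linear_rcontr: "linear (\<lambda>X. rcontr X Y)"
  unfolding rcontr_def by (rule adjoint_linear[OF wedge_linear(2)])

lemma linear_rcontr2: "linear (rcontr X)"
proof (rule linearI)
  fix Y Y' :: "'a multivector" and a :: real
  show "rcontr X (Y + Y') = rcontr X Y + rcontr X Y'"
    by (subst vector_eq_rdot[symmetric])
      (simp add: rcontr_inner inner_simps linear_add[OF linear_reversion] wedge_add)
  show "rcontr X (a *\<^sub>R Y) = a *\<^sub>R rcontr X Y"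
    by (subst vector_eq_rdot[symmetric])
      (simp add: rcontr_inner inner_simps linear_scale[OF linear_reversion] wedge_scaleR)
qed

lemma lcontr_blade: "lcontr (blade {i}) (blade K) =
    (if i \<in> K then blade_sign {i} (K - {i}) *\<^sub>R blade (K - {i}) else 0)"
proof -
  have "lcontr (blade {i}) (blade K) $ J =
      (if i \<in> K then blade_sign {i} (K - {i}) *\<^sub>R blade (K - {i}) else 0) $ J" for J
  proof -
    have "lcontr (blade {i}) (blade K) $ J = (blade {i} \<and>\<^sub>m blade J) $ K"
      using lcontr_inner[of "blade {i}" "blade K" "blade J"]
      by (metis inner_blade inner_commute mv_vec_axis reversion_mv_vec)
    also have "\<dots> = (if i \<notin> J \<and> K = insert i J then blade_sign {i} J else 0)"
      by (auto simp: wedge_blade) (auto simp: blade_def axis_def split: if_splits)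
    also have "\<dots> = (if i \<in> K then blade_sign {i} (K - {i}) *\<^sub>R blade (K - {i}) else 0) $ J"
      by (auto simp: blade_def axis_def insert_absorb)
    finally show ?thesis .
  qed
  then show ?thesis by (simp only: vec_eq_iff) blast
qed

lemma rcontr_blade: "rcontr (blade K) (blade {i}) =
    (if i \<in> K then blade_sign (K - {i}) {i} *\<^sub>R blade (K - {i}) else 0)"
proof -
  have "rcontr (blade K) (blade {i}) $ J =
      (if i \<in> K then blade_sign (K - {i}) {i} *\<^sub>R blade (K - {i}) else 0) $ J" for J
  proof -
    have "rcontr (blade K) (blade {i}) $ J = (blade J \<and>\<^sub>m blade {i}) $ K"
      using rcontr_inner[of "blade K" "blade {i}" "blade J"]
      by (metis inner_blade inner_commute mv_vec_axis reversion_mv_vec)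
    also have "\<dots> = (if i \<notin> J \<and> K = insert i J then blade_sign J {i} else 0)"
      by (auto simp: wedge_blade) (auto simp: blade_def axis_def split: if_splits)
    also have "\<dots> = (if i \<in> K then blade_sign (K - {i}) {i} *\<^sub>R blade (K - {i}) else 0) $ J"
      by (auto simp: blade_def axis_def insert_absorb)
    finally show ?thesis .
  qed
  then show ?thesis by (simp only: vec_eq_iff) blast
qed

definition grade_involution :: "'n::{finite,linorder} multivector \<Rightarrow> 'n multivector" where
  "grade_involution X = (\<chi> I. (-1) ^ card I * X $ I)"

lemma linear_grade_involution: "linear grade_involution"
  by (rule linearI) (auto simp: grade_involution_def vec_eq_iff algebra_simps)

lemma grade_involution_blade: "grade_involution (blade I) = (-1) ^ card I *\<^sub>R blade I"
  by (auto simp: grade_involution_def blade_def vec_eq_iff axis_def)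

lemma grade_involution_inner: "grade_involution X \<bullet> Z = X \<bullet> grade_involution Z"
  by (auto simp: grade_involution_def inner_vec_def intro!: sum.cong)

lemma lcontr_wedge_blade:
  fixes i j :: "'n::{finite,linorder}"
  shows "lcontr (blade {i}) (blade I \<and>\<^sub>m blade {j}) =
    lcontr (blade {i}) (blade I) \<and>\<^sub>m blade {j} + (if i = j then 1 else 0) *\<^sub>R grade_involution (blade I)"
proof (cases "j \<in> I")
  case True
  show ?thesis
  proof (cases "i = j")
    case False
    then show ?thesis using True
      by (auto simp: wedge_blade linear_0[OF linear_lcontr] lcontr_blade wedge_zero wedge_scaleR)
  next
    case ij: True
    have "card I = Suc (card (I - {j}))" using card_Suc_Diff1[OF finite True] by (rule sym)
    moreover have "blade_sign {j} (I - {j}) * blade_sign (I - {j}) {j} = (-1) ^ card (I - {j})"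
      by (rule blade_sign_swap) simp
    ultimately show ?thesis using True ij
      by (simp add: wedge_blade linear_0[OF linear_lcontr] lcontr_blade wedge_zero wedge_scaleR
          grade_involution_blade insert_absorb del: card_Diff_insert card_Diff_singleton)
  qed
next
  case False
  then have L: "lcontr (blade {i}) (blade I \<and>\<^sub>m blade {j}) =
      blade_sign I {j} *\<^sub>R lcontr (blade {i}) (blade (I \<union> {j}))"
    by (simp add: wedge_blade linear_scale[OF linear_lcontr])
  show ?thesis
  proof (cases "i = j")
    case True
    moreover have "blade_sign {j} I * blade_sign I {j} = (-1) ^ card I"
      by (rule blade_sign_swap) fact
    ultimately show ?thesis using False unfolding L
      by (simp add: lcontr_blade grade_involution_blade wedge_zero mult.commute)
  next
    case ij: False
    show ?thesis
    proof (cases "i \<in> I")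
      case True
      have 1: "blade_sign I {j} = blade_sign (I - {i}) {j} * blade_sign {i} {j}"
        using True blade_sign_Un1[of "I - {i}" "{i}" "{j}"] by (simp add: insert_absorb)
      have 2: "I \<union> {j} - {i} = (I - {i}) \<union> {j}" using ij by auto
      have 3: "blade_sign {i} ((I - {i}) \<union> {j}) = blade_sign {i} (I - {i}) * blade_sign {i} {j}"
        using False by (intro blade_sign_Un2) auto
      have "blade_sign I {j} * blade_sign {i} ((I - {i}) \<union> {j}) =
          blade_sign (I - {i}) {j} * blade_sign {i} (I - {i}) * (blade_sign {i} {j} * blade_sign {i} {j})"
        unfolding 1 3 by (simp add: mult_ac)
      also have "\<dots> = blade_sign {i} (I - {i}) * blade_sign (I - {i}) {j}"
        by (simp add: blade_sign_square)
      finally have 4: "blade_sign I {j} * blade_sign {i} ((I - {i}) \<union> {j}) =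
          blade_sign {i} (I - {i}) * blade_sign (I - {i}) {j}" .
      have "lcontr (blade {i}) (blade (I \<union> {j})) = blade_sign {i} ((I - {i}) \<union> {j}) *\<^sub>R blade ((I - {i}) \<union> {j})"
        unfolding lcontr_blade 2 using True by simp
      moreover have "lcontr (blade {i}) (blade I) \<and>\<^sub>m blade {j} =
          (blade_sign {i} (I - {i}) * blade_sign (I - {i}) {j}) *\<^sub>R blade ((I - {i}) \<union> {j})"
        using True False by (simp add: lcontr_blade wedge_scaleR wedge_blade)
      ultimately show ?thesis unfolding L using ij by (simp add: 4 del: Un_insert_right)
    next
      case iI: False
      then show ?thesis unfolding L using ij by (simp add: lcontr_blade wedge_zero)
    qed
  qed
qed

lemma lcontr_wedge_vec:
  fixes v c :: "'n::{finite,linorder} canonical"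
  shows "lcontr (mv_vec v) (X \<and>\<^sub>m mv_vec c) =
    lcontr (mv_vec v) X \<and>\<^sub>m mv_vec c + (v \<bullet> c) *\<^sub>R grade_involution X"
proof -
  note lin = linear_add[OF linear_mv_vec] linear_scale[OF linear_mv_vec]
    linear_add[OF linear_lcontr] linear_scale[OF linear_lcontr]
    linear_add[OF linear_lcontr1] linear_scale[OF linear_lcontr1]
    linear_add[OF linear_grade_involution] linear_scale[OF linear_grade_involution]
    wedge_add wedge_scaleR inner_simps algebra_simps
  have 1: "(\<lambda>X. lcontr (mv_vec (axis i 1)) (X \<and>\<^sub>m mv_vec (axis j 1))) =
    (\<lambda>X. lcontr (mv_vec (axis i 1)) X \<and>\<^sub>m mv_vec (axis j 1) + (axis i 1 \<bullet> axis j (1::real)) *\<^sub>R grade_involution X)"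
    for i j :: 'n
  proof (rule linear_eq_blade)
    show "lcontr (mv_vec (axis i 1)) (blade I \<and>\<^sub>m mv_vec (axis j 1)) =
      lcontr (mv_vec (axis i 1)) (blade I) \<and>\<^sub>m mv_vec (axis j 1) +
      (axis i 1 \<bullet> axis j (1::real)) *\<^sub>R grade_involution (blade I)" for I
      unfolding mv_vec_axis lcontr_wedge_blade by (simp add: inner_axis_axis)
  qed (auto intro!: linearI simp: lin)
  have 2: "(\<lambda>c. lcontr (mv_vec (axis i 1)) (X \<and>\<^sub>m mv_vec c)) =
    (\<lambda>c. lcontr (mv_vec (axis i 1)) X \<and>\<^sub>m mv_vec c + (axis i 1 \<bullet> c) *\<^sub>R grade_involution X)"
    for i :: 'n
    by (rule linear_eq_axis) (auto intro!: linearI simp: lin fun_cong[OF 1])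
  have "(\<lambda>v. lcontr (mv_vec v) (X \<and>\<^sub>m mv_vec c)) =
    (\<lambda>v. lcontr (mv_vec v) X \<and>\<^sub>m mv_vec c + (v \<bullet> c) *\<^sub>R grade_involution X)"
    by (rule linear_eq_axis) (auto intro!: linearI simp: lin fun_cong[OF 2])
  then show ?thesis by (rule fun_cong)
qed

definition clifford_left :: "('n canonical \<Rightarrow> 'n canonical) \<Rightarrow> 'n canonical \<Rightarrow>
    'n::{finite,linorder} multivector \<Rightarrow> 'n multivector" where
  "clifford_left m b X = lcontr (mv_vec (m b)) X + mv_vec b \<and>\<^sub>m X"

definition clifford_right :: "('n canonical \<Rightarrow> 'n canonical) \<Rightarrow> 'n canonical \<Rightarrow>
    'n::{finite,linorder} multivector \<Rightarrow> 'n multivector" where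
  "clifford_right m b X = rcontr X (mv_vec (m b)) + X \<and>\<^sub>m mv_vec b"

lemma linear_clifford_left: "linear (clifford_left m b)"
  unfolding clifford_left_def by (intro linear_compose_add linear_lcontr wedge_linear)

lemma linear_clifford_right: "linear (clifford_right m b)"
  unfolding clifford_right_def by (intro linear_compose_add linear_rcontr wedge_linear)

lemma clifford_left_right_commute:
  fixes m :: "'n::{finite,linorder} canonical \<Rightarrow> 'n canonical"
  assumes "\<And>v w. m v \<bullet> w = v \<bullet> m w"
  shows "clifford_left m b (clifford_right m c X) = clifford_right m c (clifford_left m b X)"
proof -
  have 1: "lcontr (mv_vec (m b)) (rcontr X (mv_vec (m c))) = rcontr (lcontr (mv_vec (m b)) X) (mv_vec (m c))"
    by (subst vector_eq_rdot[symmetric])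
      (simp add: lcontr_inner rcontr_inner reversion_mv_vec wedge_assoc)
  have 2: "rcontr (mv_vec b \<and>\<^sub>m X) (mv_vec (m c)) =
      mv_vec b \<and>\<^sub>m rcontr X (mv_vec (m c)) + (b \<bullet> m c) *\<^sub>R grade_involution X"
  proof (subst vector_eq_rdot[symmetric], intro allI)
    fix Z
    have "rcontr (mv_vec b \<and>\<^sub>m X) (mv_vec (m c)) \<bullet> Z = X \<bullet> lcontr (mv_vec b) (Z \<and>\<^sub>m mv_vec (m c))"
      by (simp add: rcontr_inner reversion_mv_vec lcontr_inner inner_commute[of X])
        (simp add: inner_commute)
    also have "\<dots> = rcontr X (mv_vec (m c)) \<bullet> lcontr (mv_vec b) Z + (b \<bullet> m c) * (grade_involution X \<bullet> Z)"
      by (simp add: lcontr_wedge_vec inner_simps grade_involution_inner rcontr_inner reversion_mv_vec)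
    also have "rcontr X (mv_vec (m c)) \<bullet> lcontr (mv_vec b) Z = (mv_vec b \<and>\<^sub>m rcontr X (mv_vec (m c))) \<bullet> Z"
      by (metis inner_commute lcontr_inner reversion_mv_vec)
    finally show "rcontr (mv_vec b \<and>\<^sub>m X) (mv_vec (m c)) \<bullet> Z =
      (mv_vec b \<and>\<^sub>m rcontr X (mv_vec (m c)) + (b \<bullet> m c) *\<^sub>R grade_involution X) \<bullet> Z"
      by (simp add: inner_simps)
  qed
  show ?thesis unfolding clifford_left_def clifford_right_def
    by (simp add: linear_add[OF linear_lcontr] linear_add[OF linear_rcontr] wedge_add
        1 2 lcontr_wedge_vec assms wedge_assoc algebra_simps)
qed

lemma clifford_left_generates:
  fixes S :: "'n::{finite,linorder} multivector set"
  assumes S: "subspace S" and one: "mv_scalar 1 \<in> S"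
    and step: "\<And>b X. X \<in> S \<Longrightarrow> clifford_left m b X \<in> S"
  shows "X \<in> S"
proof -
  have "blade I \<in> S" for I
  proof (induction "card I" arbitrary: I rule: less_induct)
    case less
    show ?case
    proof (cases "I = {}")
      case True then show ?thesis using one by (simp add: mv_scalar_def)
    next
      case False
      then obtain i where i: "i \<in> I" by auto
      have c: "card (I - {i}) < card I" using i by (intro card_Diff1_less) simp_all
      have "blade (I - {i}) \<in> S" using less[OF c] .
      then have 1: "clifford_left m (axis i 1) (blade (I - {i})) \<in> S" by (rule step)
      have l: "lcontr (blade {j}) (blade (I - {i})) \<in> S" for j
      proof -
        have "card (I - {i} - {j}) < card I" using c
          by (meson Diff_subset card_mono finite le_less_trans)
        then show ?thesis using less S by (auto simp: lcontr_blade subspace_scale subspace_0)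
      qed
      have "lcontr (mv_vec v) (blade (I - {i})) \<in> S" for v
      proof -
        have "lcontr (mv_vec v) (blade (I - {i})) = (\<Sum>j\<in>UNIV. v $ j *\<^sub>R lcontr (blade {j}) (blade (I - {i})))"
          unfolding mv_vec_def by (simp add: linear_sum[OF linear_lcontr1] linear_scale[OF linear_lcontr1])
        also have "\<dots> \<in> S" by (intro subspace_sum[OF S] subspace_scale[OF S] l)
        finally show ?thesis .
      qed
      then have "clifford_left m (axis i 1) (blade (I - {i})) -
          lcontr (mv_vec (m (axis i 1))) (blade (I - {i})) \<in> S"
        by (intro subspace_diff[OF S] 1)
      then have "blade {i} \<and>\<^sub>m blade (I - {i}) \<in> S" by (simp add: clifford_left_def mv_vec_axis)
      then have "blade_sign {i} (I - {i}) *\<^sub>R blade I \<in> S"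
        using i by (simp add: wedge_blade insert_absorb)
      from subspace_scale[OF S this, of "blade_sign {i} (I - {i})"]
      show ?thesis by (simp add: blade_sign_square)
    qed
  qed
  then show ?thesis by (subst mv_expand) (intro subspace_sum[OF S] subspace_scale[OF S])
qed

lemma clifford_right_generates:
  fixes S :: "'n::{finite,linorder} multivector set"
  assumes S: "subspace S" and one: "mv_scalar 1 \<in> S"
    and step: "\<And>b X. X \<in> S \<Longrightarrow> clifford_right m b X \<in> S"
  shows "X \<in> S"
proof -
  have "blade I \<in> S" for I
  proof (induction "card I" arbitrary: I rule: less_induct)
    case less
    show ?case
    proof (cases "I = {}")
      case True then show ?thesis using one by (simp add: mv_scalar_def)
    next
      case False
      then obtain i where i: "i \<in> I" by auto
      have c: "card (I - {i}) < card I" using i by (intro card_Diff1_less) simp_all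
      have "blade (I - {i}) \<in> S" using less[OF c] .
      then have 1: "clifford_right m (axis i 1) (blade (I - {i})) \<in> S" by (rule step)
      have l: "rcontr (blade (I - {i})) (blade {j}) \<in> S" for j
      proof -
        have "card (I - {i} - {j}) < card I" using c
          by (meson Diff_subset card_mono finite le_less_trans)
        then show ?thesis using less S by (auto simp: rcontr_blade subspace_scale subspace_0)
      qed
      have "rcontr (blade (I - {i})) (mv_vec v) \<in> S" for v
      proof -
        have "rcontr (blade (I - {i})) (mv_vec v) = (\<Sum>j\<in>UNIV. v $ j *\<^sub>R rcontr (blade (I - {i})) (blade {j}))"
          unfolding mv_vec_def by (simp add: linear_sum[OF linear_rcontr2] linear_scale[OF linear_rcontr2])
        also have "\<dots> \<in> S" by (intro subspace_sum[OF S] subspace_scale[OF S] l)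
        finally show ?thesis .
      qed
      then have "clifford_right m (axis i 1) (blade (I - {i})) -
          rcontr (blade (I - {i})) (mv_vec (m (axis i 1))) \<in> S"
        by (intro subspace_diff[OF S] 1)
      then have "blade (I - {i}) \<and>\<^sub>m blade {i} \<in> S" by (simp add: clifford_right_def mv_vec_axis)
      then have "blade_sign (I - {i}) {i} *\<^sub>R blade I \<in> S"
        using i by (simp add: wedge_blade insert_absorb)
      from subspace_scale[OF S this, of "blade_sign (I - {i}) {i}"]
      show ?thesis by (simp add: blade_sign_square)
    qed
  qed
  then show ?thesis by (subst mv_expand) (intro subspace_sum[OF S] subspace_scale[OF S])
qed

lemma contr_one: "lcontr (mv_vec v) (mv_scalar 1) = 0" "rcontr (mv_scalar 1) (mv_vec v) = 0"
  unfolding mv_vec_def mv_scalar_def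
  by (simp_all add: linear_sum[OF linear_lcontr1] linear_scale[OF linear_lcontr1]
      linear_sum[OF linear_rcontr2] linear_scale[OF linear_rcontr2] lcontr_blade rcontr_blade)

theorem clifford_product_ex1:
  fixes m :: "'n::{finite,linorder} canonical \<Rightarrow> 'n canonical"
  assumes lin: "linear m" and sym: "\<And>v w. m v \<bullet> w = v \<bullet> m w"
  shows "\<exists>!P. is_clifford_product m P"
proof (rule ex_ex1I)
  define A where "A = {T. linear T \<and> (\<forall>c X. T (clifford_right m c X) = clifford_right m c (T X))}"
  have inj: "T = T'" if T: "T \<in> A" "T' \<in> A" and eq: "T (mv_scalar 1) = T' (mv_scalar 1)" for T T'
  proof
    fix X
    have l: "linear T" "linear T'" using T by (auto simp: A_def)
    have "subspace {X. T X = T' X}"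
      unfolding subspace_def using l by (auto simp: linear_0 linear_add linear_scale)
    from clifford_right_generates[OF this, of m X] show "T X = T' X"
      using T eq by (auto simp: A_def)
  qed
  have comp: "T \<circ> T' \<in> A" if "T \<in> A" "T' \<in> A" for T T'
    using that by (auto simp: A_def intro: linear_compose)
  have left: "clifford_left m b \<in> A" for b
    using linear_clifford_left clifford_left_right_commute[OF sym] by (auto simp: A_def)
  have add: "(\<lambda>X. T X + T' X) \<in> A" if "T \<in> A" "T' \<in> A" for T T'
    using that by (auto simp: A_def linear_add[OF linear_clifford_right] intro: linear_compose_add)
  have scale: "(\<lambda>X. a *\<^sub>R T X) \<in> A" if "T \<in> A" for T a
    using that by (auto simp: A_def linear_scale[OF linear_clifford_right]
      intro: linear_compose_scale_right)
  have idA: "(\<lambda>X. X) \<in> A" by (auto simp: A_def linear_ident)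
  have surj: "\<exists>T\<in>A. T (mv_scalar 1) = X" for X
  proof -
    have "subspace {X. \<exists>T\<in>A. T (mv_scalar 1) = X}"
      unfolding subspace_def
    proof (intro conjI ballI allI)
      show "0 \<in> {X. \<exists>T\<in>A. T (mv_scalar 1) = X}" using scale[OF idA, of 0] by force
      show "x + y \<in> {X. \<exists>T\<in>A. T (mv_scalar 1) = X}"
        if "x \<in> {X. \<exists>T\<in>A. T (mv_scalar 1) = X}" "y \<in> {X. \<exists>T\<in>A. T (mv_scalar 1) = X}" for x y
        using that add by force
      show "a *\<^sub>R x \<in> {X. \<exists>T\<in>A. T (mv_scalar 1) = X}"
        if "x \<in> {X. \<exists>T\<in>A. T (mv_scalar 1) = X}" for a x
        using that scale by force
    qed
    moreover have "mv_scalar 1 \<in> {X. \<exists>T\<in>A. T (mv_scalar 1) = X}" using idA by auto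
    moreover have "clifford_left m b X \<in> {X. \<exists>T\<in>A. T (mv_scalar 1) = X}"
      if "X \<in> {X. \<exists>T\<in>A. T (mv_scalar 1) = X}" for b X
    proof -
      from that obtain T where "T \<in> A" "T (mv_scalar 1) = X" by auto
      with comp[OF left, of T b] show ?thesis by (auto intro!: bexI[of _ "clifford_left m b \<circ> T"])
    qed
    ultimately have "X \<in> {X. \<exists>T\<in>A. T (mv_scalar 1) = X}" by (rule clifford_left_generates)
    then show ?thesis by simp
  qed
  obtain T where T: "T X \<in> A" "T X (mv_scalar 1) = X" for X using surj by metis
  have Tlin: "linear (T X)" and Tcomm: "T X (clifford_right m c Y) = clifford_right m c (T X Y)" for X Y c
    using T(1) by (auto simp: A_def)
  have right1: "clifford_right m b (mv_scalar 1) = mv_vec b" for b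
    by (simp add: clifford_right_def contr_one wedge_scalar)
  have Tassoc: "T (T X Y) Z = T X (T Y Z)" for X Y Z
    using inj[OF T(1) comp[OF T(1) T(1)], of "T X Y" X Y] by (simp add: T(2) fun_eq_iff)
  have Tadd: "T (X + Y) Z = T X Z + T Y Z" for X Y Z
    using inj[OF T(1) add[OF T(1) T(1)], of "X + Y" X Y] by (simp add: T(2) fun_eq_iff)
  have Tscale: "T (a *\<^sub>R X) Z = a *\<^sub>R T X Z" for X a Z
    using inj[OF T(1) scale[OF T(1)], of "a *\<^sub>R X" a X] by (simp add: T(2) fun_eq_iff)
  have Tone: "T (mv_scalar 1) Z = Z" for Z
    using inj[OF T(1) idA, of "mv_scalar 1"] by (simp add: T(2) fun_eq_iff)
  have sc: "mv_scalar a = a *\<^sub>R mv_scalar 1" for a by (simp add: mv_scalar_def)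
  have Tleft: "T (mv_vec b) = clifford_left m b" for b
    by (rule inj[OF T(1) left]) (simp add: T(2) clifford_left_def contr_one wedge_scalar)
  have "is_clifford_product m T"
    unfolding is_clifford_product_def bilinear_def
  proof (intro conjI allI)
    show "linear (\<lambda>x. T x y)" for y by (rule linearI) (auto simp: Tadd Tscale)
    show "T (mv_scalar a) X = a *\<^sub>R X" for a X by (subst sc) (simp add: Tscale Tone)
    show "T X (mv_scalar a) = a *\<^sub>R X" for a X
      by (subst sc) (simp add: linear_scale[OF Tlin] T(2))
    show "T (mv_vec b) X = lcontr (mv_vec (m b)) X + mv_vec b \<and>\<^sub>m X" for b X
      by (simp add: Tleft clifford_left_def)
    show "T X (mv_vec b) = rcontr X (mv_vec (m b)) + X \<and>\<^sub>m mv_vec b" for b X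
      using Tcomm[of X b "mv_scalar 1"] by (simp add: right1 T(2)) (simp add: clifford_right_def)
  qed (simp_all add: Tlin Tassoc)
  then show "\<exists>P. is_clifford_product m P" by blast
next
  fix P Q assume P: "is_clifford_product m P" and Q: "is_clifford_product m Q"
  have "P X = Q X" for X
  proof -
    have lP: "linear (\<lambda>X. P X Y)" and lQ: "linear (\<lambda>X. Q X Y)" for Y
      using P Q by (auto simp: is_clifford_product_def bilinear_def)
    have S: "subspace {X. P X = Q X}"
      unfolding subspace_def
      using linear_0[OF lP] linear_0[OF lQ] linear_add[OF lP] linear_add[OF lQ]
        linear_scale[OF lP] linear_scale[OF lQ] by (auto simp: fun_eq_iff)
    have step: "P (clifford_left m b X) = Q (clifford_left m b X)" if "P X = Q X" for b X
    proof -
      have "P (P (mv_vec b) X) Y = Q (Q (mv_vec b) X) Y" for Y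
        using P Q that unfolding is_clifford_product_def by metis
      then show ?thesis using P Q unfolding is_clifford_product_def clifford_left_def
        by (auto simp: fun_eq_iff)
    qed
    have "P (mv_scalar 1) = Q (mv_scalar 1)"
      using P Q unfolding is_clifford_product_def fun_eq_iff by metis
    then show ?thesis using clifford_left_generates[OF S, of m X] step by auto
  qed
  then show "P = Q" by (rule ext)
qed

end

theory Submission
  imports Defs
begin

text \<open>
  Let \<open>I = b\<^sub>1 \<and> \<dots> \<and> b\<^sub>n\<close>. For every \<open>m\<close>-Clifford product \<open>I(b \<and> X) = (-1)\<^sup>n\<^sup>+\<^sup>1 m(b) \<lrcorner> (IX)\<close>,
  because \<open>b \<and> X\<close> and \<open>m(b) \<lrcorner> X\<close> are half the sum and half the difference of \<open>bX\<close> and \<open>X\<^sup>*b\<close>, where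
  \<open>X\<^sup>*\<close> is the grade involution of \<open>X\<close>, and left multiplication by \<open>I\<close> exchanges the two up to sign.
  Since \<open>\<tau>\<close> is a locally constant multiple of \<open>I\<close>, it passes through \<open>\<partial>\<^sub>o\<close>, which gives the Euclidean
  formula. The second formula follows from the first by \<open>g(IX) = det[g] I \<diamondop> X\<close> for the \<open>g\<^sup>-\<^sup>1\<close>-Clifford
  product: as functions of \<open>X\<close> both sides agree at 1 and satisfy the same recursion for \<open>b \<and> X\<close>.
\<close>

section \<open>Top-degree wedge products\<close>

lemma wedge_family_cong:
  assumes "\<And>i. i \<in> I \<Longrightarrow> v i = w i"
  shows "wedge_family v I = wedge_family w I"
  unfolding wedge_family_def using assms by (intro arg_cong[where f=wedge_list]) simp

lemma mv_vec_add: "mv_vec (v + w) = mv_vec v + mv_vec w"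
  and mv_vec_scaleR: "mv_vec (a *\<^sub>R v) = a *\<^sub>R mv_vec v"
  and mv_vec_zero: "mv_vec 0 = 0"
  using linear_add[OF linear_mv_vec] linear_scale[OF linear_mv_vec] linear_0[OF linear_mv_vec] by auto

text \<open>Moving the factor \<open>v i\<close> to the front costs
  \<open>blade_sign {i} (I - {i})\<close>, and a sign is its own inverse. Later arguments about one
  or two factors can thus ignore the order of the index set.\<close>

lemma wedge_family_extract:
  assumes "i \<in> I"
  shows "wedge_family v I = blade_sign {i} (I - {i}) *\<^sub>R (mv_vec (v i) \<and>\<^sub>m wedge_family v (I - {i}))"
  using assms by (simp add: wedge_vec_family insert_absorb blade_sign_square)

text \<open>Extends \<open>outermorphism_blade\<close> from basis vectors to arbitrary families, by
  induction along the list of factors. It yields multiplicativity of the determinant factor in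
  \<open>wedge_family_UNIV\<close>.\<close>

lemma wedge_family_outermorphism:
  fixes f :: "'n::{finite,linorder} canonical \<Rightarrow> 'n canonical"
  assumes "linear f"
  shows "wedge_family (\<lambda>i. f (v i)) I = outermorphism f (wedge_family v I)"
proof -
  have "wedge_list (map (\<lambda>i. mv_vec (f (v i))) xs) = outermorphism f (wedge_list (map (\<lambda>i. mv_vec (v i)) xs))"
    for xs :: "'n list"
    by (induction xs) (simp_all add: wedge_list_def outermorphism_scalar outermorphism_wedge
        outermorphism_vec[OF assms])
  then show ?thesis by (simp add: wedge_family_def)
qed

lemma wedge_family_scaleR:
  "wedge_family (\<lambda>i. a i *\<^sub>R v i) I = (\<Prod>i\<in>I. a i) *\<^sub>R wedge_family v I"
proof (induction I rule: infinite_finite_induct)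
  case (insert i I)
  have "wedge_family (\<lambda>i. a i *\<^sub>R v i) (insert i I) =
      blade_sign {i} I *\<^sub>R (mv_vec (a i *\<^sub>R v i) \<and>\<^sub>m wedge_family (\<lambda>i. a i *\<^sub>R v i) I)"
    using wedge_family_extract[of i "insert i I" "\<lambda>i. a i *\<^sub>R v i"] insert.hyps by simp
  moreover have "wedge_family v (insert i I) = blade_sign {i} I *\<^sub>R (mv_vec (v i) \<and>\<^sub>m wedge_family v I)"
    using wedge_family_extract[of i "insert i I" v] insert.hyps by simp
  ultimately show ?case using insert by (simp add: mv_vec_scaleR wedge_scaleR mult_ac)
qed (simp_all add: wedge_family_empty)

lemma wedge_family_zero:
  assumes "i \<in> I" "v i = 0"
  shows "wedge_family v I = 0"
  using assms wedge_family_extract[of i I v] by (simp add: mv_vec_zero wedge_zero)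

text \<open>Once factor \<open>i\<close> is in front, the added term wedges \<open>v j\<close> with
  a product that already contains \<open>v j\<close>, so it vanishes.\<close>

lemma wedge_family_add_other:
  assumes "i \<in> I" "j \<in> I" "i \<noteq> j"
  shows "wedge_family (v(i := v i + c *\<^sub>R v j)) I = wedge_family v I"
proof -
  have "wedge_family (v(i := v i + c *\<^sub>R v j)) (I - {i}) = wedge_family v (I - {i})"
    by (rule wedge_family_cong) auto
  moreover have "mv_vec (v j) \<and>\<^sub>m wedge_family v (I - {i}) = 0"
    using assms by (simp add: wedge_vec_family)
  ultimately show ?thesis using assms(1)
    by (simp add: wedge_family_extract[of i I] mv_vec_add mv_vec_scaleR wedge_add wedge_scaleR)
qed

lemma wedge_family_swap:
  assumes "i \<in> I" "j \<in> I" "i \<noteq> j"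
  shows "wedge_family (\<lambda>k. v (Transposition.transpose i j k)) I = - wedge_family v I"
proof -
  define W where "W = wedge_family v (I - {i} - {j})"
  \<comment> \<open>The sign of bringing the factors at \<open>i\<close> and \<open>j\<close> to the
    front. It depends on the index set only, hence is the same before and after the swap.\<close>
  define s where "s = blade_sign {i} (I - {i}) * blade_sign {j} (I - {i} - {j})"
  have *: "wedge_family w I = s *\<^sub>R (mv_vec (w i) \<and>\<^sub>m mv_vec (w j) \<and>\<^sub>m W)"
    if "\<And>k. k \<in> I - {i} - {j} \<Longrightarrow> w k = v k" for w
  proof -
    have "wedge_family w (I - {i} - {j}) = W"
      unfolding W_def using that by (rule wedge_family_cong)
    then show ?thesis
      using assms wedge_family_extract[of i I w] wedge_family_extract[of j "I - {i}" w]
      by (simp add: s_def wedge_scaleR)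
  qed
  have "mv_vec (v j) \<and>\<^sub>m mv_vec (v i) \<and>\<^sub>m W = - (mv_vec (v i) \<and>\<^sub>m mv_vec (v j) \<and>\<^sub>m W)"
    unfolding wedge_assoc[symmetric]
    by (subst wedge_vec_anticomm) (metis linear_neg[OF wedge_linear(2)])
  then show ?thesis
    using *[of "\<lambda>k. v (Transposition.transpose i j k)"] *[of v]
    by (simp add: Transposition.transpose_def)
qed

text \<open>Induction over products of elementary matrices: the top-degree wedge of the rows reacts
  to scaling, swapping and shearing rows exactly as the determinant does.\<close>

lemma wedge_family_UNIV:
  fixes v :: "'n::{finite,linorder} \<Rightarrow> 'n canonical"
  shows "wedge_family v UNIV = det (\<chi> i. v i) *\<^sub>R blade UNIV"
proof -
  have "wedge_family (($) A) UNIV = det A *\<^sub>R blade UNIV" for A :: "((real, 'n) vec, 'n) vec"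
  proof (induction A rule: induct_matrix_elementary)
    case (1 A B)
    \<comment> \<open>The rows of \<open>A ** B\<close> are the images of the rows of
      \<open>A\<close> under right multiplication by \<open>B\<close>, so their wedge is an
      outermorphism applied to the wedge of the rows of \<open>A\<close>.\<close>
    have rows: "($) (A ** B) = (\<lambda>i. A $ i v* B)"
      by (auto simp: matrix_matrix_mult_def vector_matrix_mult_def vec_eq_iff fun_eq_iff)
    have lin: "linear (\<lambda>x. x v* B)" 
      by (rule linearI) (simp_all add: vector_matrix_mult_def vec_eq_iff algebra_simps sum.distrib sum_distrib_left)
    have "axis i 1 v* B = B $ i" for i
      by (simp add: vector_matrix_mult_def axis_def vec_eq_iff if_distrib if_distribR cong: if_cong)
    then have "outermorphism (\<lambda>x. x v* B) (blade UNIV) = wedge_family (($) B) UNIV"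
      by (simp add: outermorphism_blade)
    then show ?case
      unfolding rows wedge_family_outermorphism[OF lin] 1 det_mul
      by (simp add: linear_scale[OF linear_outermorphism] 1)
  next
    case (2 A i)
    then have "A $ i = 0" by (simp add: row_def vec_eq_iff)
    then show ?case using 2 by (simp add: wedge_family_zero det_zero_row)
  next
    case (3 A)
    have rows: "($) A = (\<lambda>i. (A $ i $ i) *\<^sub>R axis i 1)"
      using 3 by (auto simp: fun_eq_iff vec_eq_iff axis_def)
    show ?case
      by (subst rows) (simp add: wedge_family_scaleR wedge_family_axis det_diagonal[OF 3])
  next
    case (4 m n)
    let ?p = "Transposition.transpose m n"
    have "($) (\<chi> i j. mat (1::real) $ i $ ?p j) = (\<lambda>i. axis (?p i) 1)"
      by (auto simp: fun_eq_iff vec_eq_iff axis_def mat_def Transposition.transpose_def)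
    moreover have "det (\<chi> i j. mat (1::real) $ i $ ?p j) = -1"
      using 4 det_permute_columns[of ?p "mat 1 :: ((real, 'n) vec, 'n) vec"]
      by (simp add: permutes_swap_id sign_swap_id)
    ultimately show ?case
      using wedge_family_swap[of m UNIV n "\<lambda>i. axis i 1"] 4 by (simp add: wedge_family_axis)
  next
    case (5 m n c)
    let ?A = "\<chi> i j. if i = m \<and> j = n then c else of_bool (i = j)"
    let ?w = "\<lambda>i. axis i (1::real)"
    have rows: "($) ?A = ?w(m := ?w m + c *\<^sub>R ?w n)"
      using 5 by (auto simp: fun_eq_iff vec_eq_iff axis_def)
    have "?A = (\<chi> k. if k = m then row m (mat 1) + c *s row n (mat 1) else row k (mat 1))"
      using 5 by (auto simp: vec_eq_iff row_def mat_def)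
    then have det: "det ?A = 1" using det_row_operation[OF 5, of "mat 1" c] by simp
    show ?case
      unfolding rows det using wedge_family_add_other[of m UNIV n ?w c] 5
      by (simp add: wedge_family_axis del: fun_upd_apply)
  qed
  moreover have "($) (\<chi> i. v i) = v" by (simp add: fun_eq_iff)
  ultimately show ?thesis by metis
qed

text \<open>The images of the basis vectors are the columns of \<open>matrix f\<close>, whereas
  \<open>wedge_family_UNIV\<close> speaks of rows; the transpose bridges the two.\<close>

lemma outermorphism_pseudoscalar:
  fixes f :: "'n::{finite,linorder} canonical \<Rightarrow> 'n canonical"
  shows "outermorphism f (blade UNIV) = det (matrix f) *\<^sub>R blade UNIV"
proof -
  have "(\<chi> i. f (axis i 1)) = Finite_Cartesian_Product.transpose (matrix f)"
    by (simp add: matrix_def Finite_Cartesian_Product.transpose_def vec_eq_iff)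
  then show ?thesis by (simp add: outermorphism_blade wedge_family_UNIV det_transpose)
qed

section \<open>Grade involution and vectors\<close>

lemma linear_eq_subspace:
  assumes "linear F" "linear G"
  shows "subspace {X. F X = G X}"
  unfolding subspace_def using assms by (auto simp: linear_0 linear_add linear_scale)

text \<open>For the zero map Clifford multiplication by a vector is the wedge product, so
  \<open>clifford_right_generates\<close> becomes an induction principle for the exterior
  algebra.\<close>

lemma linear_eq_wedge_vec_induct:
  fixes F G :: "'n::{finite,linorder} multivector \<Rightarrow> 'n multivector"
  assumes "linear F" "linear G" and one: "F (mv_scalar 1) = G (mv_scalar 1)"
    and step: "\<And>b X. F X = G X \<Longrightarrow> F (X \<and>\<^sub>m mv_vec b) = G (X \<and>\<^sub>m mv_vec b)"
  shows "F X = G X"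
proof -
  have "clifford_right (\<lambda>_. 0) b X = X \<and>\<^sub>m mv_vec b" for b and X :: "'n multivector"
    by (simp add: clifford_right_def mv_vec_zero linear_0[OF linear_rcontr2])
  then show ?thesis
    using clifford_right_generates[OF linear_eq_subspace[OF assms(1,2)], of "\<lambda>_. 0" X] one step by simp
qed

lemma linear_eq_vec_wedge_induct:
  fixes F G :: "'n::{finite,linorder} multivector \<Rightarrow> 'n multivector"
  assumes "linear F" "linear G" and one: "F (mv_scalar 1) = G (mv_scalar 1)"
    and step: "\<And>b X. F X = G X \<Longrightarrow> F (mv_vec b \<and>\<^sub>m X) = G (mv_vec b \<and>\<^sub>m X)"
  shows "F X = G X"
proof -
  have "clifford_left (\<lambda>_. 0) b X = mv_vec b \<and>\<^sub>m X" for b and X :: "'n multivector"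
    by (simp add: clifford_left_def mv_vec_zero linear_0[OF linear_lcontr1])
  then show ?thesis
    using clifford_left_generates[OF linear_eq_subspace[OF assms(1,2)], of "\<lambda>_. 0" X] one step by simp
qed

lemma grade_involution_involutive: "grade_involution (grade_involution X) = X"
  by (simp add: grade_involution_def vec_eq_iff power_mult_distrib[symmetric] mult.assoc[symmetric])

lemma grade_involution_mv_vec: "grade_involution (mv_vec b) = - mv_vec b"
  unfolding mv_vec_def
  by (simp add: linear_sum[OF linear_grade_involution] linear_scale[OF linear_grade_involution]
      grade_involution_blade sum_negf)

lemma grade_involution_one: "grade_involution (mv_scalar a) = mv_scalar a"
  by (simp add: mv_scalar_def linear_scale[OF linear_grade_involution] grade_involution_blade)

lemma grade_involution_wedge:
  "grade_involution (X \<and>\<^sub>m Y) = grade_involution X \<and>\<^sub>m grade_involution Y"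
proof -
  note lin = linear_add[OF linear_grade_involution] linear_scale[OF linear_grade_involution]
    linear_0[OF linear_grade_involution]
  have 1: "(\<lambda>Y. grade_involution (blade I \<and>\<^sub>m Y)) =
      (\<lambda>Y. grade_involution (blade I) \<and>\<^sub>m grade_involution Y)" for I :: "'a set"
  proof (rule linear_eq_blade)
    show "grade_involution (blade I \<and>\<^sub>m blade J) =
        grade_involution (blade I) \<and>\<^sub>m grade_involution (blade J)" for J
      by (simp add: wedge_blade grade_involution_blade wedge_scaleR lin card_Un_disjoint power_add mult_ac)
  qed (auto intro!: linearI simp: wedge_add wedge_scaleR lin)
  have "(\<lambda>X. grade_involution (X \<and>\<^sub>m Y)) = (\<lambda>X. grade_involution X \<and>\<^sub>m grade_involution Y)"
    by (rule linear_eq_blade) (auto intro!: linearI simp: wedge_add wedge_scaleR lin fun_cong[OF 1])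
  then show ?thesis by (rule fun_cong)
qed

text \<open>Moving \<open>b\<close> past each vector factor of \<open>X\<close> produces one sign,
  and grade involution collects these signs.\<close>

lemma wedge_vec_grade_involution: "mv_vec b \<and>\<^sub>m X = grade_involution X \<and>\<^sub>m mv_vec b"
proof (rule linear_eq_wedge_vec_induct[OF wedge_linear(1)
      linear_compose[OF linear_grade_involution wedge_linear(2), unfolded o_def]])
  show "mv_vec b \<and>\<^sub>m mv_scalar 1 = grade_involution (mv_scalar 1) \<and>\<^sub>m mv_vec b"
    by (simp add: grade_involution_one wedge_scalar)
next
  fix c X assume IH: "mv_vec b \<and>\<^sub>m X = grade_involution X \<and>\<^sub>m mv_vec b"
  have "mv_vec b \<and>\<^sub>m X \<and>\<^sub>m mv_vec c = grade_involution X \<and>\<^sub>m mv_vec b \<and>\<^sub>m mv_vec c"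
    by (simp add: wedge_assoc[symmetric] IH)
  also have "\<dots> = - (grade_involution X \<and>\<^sub>m mv_vec c \<and>\<^sub>m mv_vec b)"
    by (subst wedge_vec_anticomm) (metis linear_neg[OF wedge_linear(1)])
  also have "\<dots> = grade_involution (X \<and>\<^sub>m mv_vec c) \<and>\<^sub>m mv_vec b"
    by (simp add: grade_involution_wedge grade_involution_mv_vec linear_neg[OF wedge_linear(1)]
        linear_neg[OF wedge_linear(2)] wedge_assoc)
  finally show "mv_vec b \<and>\<^sub>m X \<and>\<^sub>m mv_vec c = grade_involution (X \<and>\<^sub>m mv_vec c) \<and>\<^sub>m mv_vec b" .
qed

lemma lcontr_grade_involution:
  "lcontr (mv_vec b) (grade_involution X) = - grade_involution (lcontr (mv_vec b) X)"
  by (subst vector_eq_rdot[symmetric])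
    (simp add: lcontr_inner reversion_mv_vec grade_involution_inner grade_involution_wedge
      grade_involution_mv_vec linear_neg[OF wedge_linear(2)])

text \<open>The adjoint form of \<open>wedge_vec_grade_involution\<close>, since grade involution is
  self-adjoint.\<close>

lemma rcontr_grade_involution:
  "rcontr X (mv_vec b) = grade_involution (lcontr (mv_vec b) X)"
  by (subst vector_eq_rdot[symmetric])
    (simp add: lcontr_inner rcontr_inner reversion_mv_vec grade_involution_inner
      wedge_vec_grade_involution grade_involution_involutive)

lemma wedge_vec_pseudoscalar:
  "mv_vec b \<and>\<^sub>m blade (UNIV :: 'n::{finite,linorder} set) = 0"
  by (simp add: mv_vec_def linear_sum[OF wedge_linear(2)] wedge_scaleR wedge_blade)

lemma grade_involution_outermorphism:
  fixes f :: "'n::{finite,linorder} canonical \<Rightarrow> 'n canonical"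
  assumes "linear f"
  shows "grade_involution (outermorphism f X) = outermorphism f (grade_involution X)"
proof (induction X rule: linear_eq_wedge_vec_induct[OF
      linear_compose[OF linear_outermorphism linear_grade_involution, unfolded o_def]
      linear_compose[OF linear_grade_involution linear_outermorphism, unfolded o_def]])
  case 1 show ?case by (simp add: grade_involution_one outermorphism_scalar)
next
  case (2 b X)
  then show ?case
    by (simp add: outermorphism_wedge grade_involution_wedge outermorphism_vec[OF assms]
        grade_involution_mv_vec linear_neg[OF linear_outermorphism])
qed

text \<open>Contraction by a vector obeys the graded product rule \<open>lcontr_wedge_vec\<close>.
  Both sides therefore satisfy the same recursion, their scalar terms agreeing by the definition of
  the adjoint.\<close>

lemma lcontr_outermorphism:
  fixes f :: "'n::{finite,linorder} canonical \<Rightarrow> 'n canonical"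
  assumes f: "linear f"
  shows "lcontr (mv_vec v) (outermorphism f X) = outermorphism f (lcontr (mv_vec (adjoint f v)) X)"
proof (induction X rule: linear_eq_wedge_vec_induct[OF
      linear_compose[OF linear_outermorphism linear_lcontr, unfolded o_def]
      linear_compose[OF linear_lcontr linear_outermorphism, unfolded o_def]])
  case 1 show ?case by (simp add: outermorphism_scalar contr_one linear_0[OF linear_outermorphism])
next
  case (2 b X)
  have "adjoint f v \<bullet> b = v \<bullet> f b" using adjoint_works[OF f] by (metis inner_commute)
  then show ?case
    by (simp add: outermorphism_wedge outermorphism_vec[OF f] lcontr_wedge_vec 2
        grade_involution_outermorphism[OF f] linear_add[OF linear_outermorphism]
        linear_scale[OF linear_outermorphism])
qed

section \<open>Clifford multiplication by the pseudoscalar\<close>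

text \<open>The hypotheses of \<open>clifford_product_ex1\<close>, under which the definite
  description behind \<open>clifford_product\<close> denotes an actual product.\<close>

locale metric_map =
  fixes m :: "'n::{finite,linorder} canonical \<Rightarrow> 'n canonical"
  assumes linear: "linear m" and symmetric: "m v \<bullet> w = v \<bullet> m w"
begin

abbreviation prod (infixl "\<diamondop>" 75) where "X \<diamondop> Y \<equiv> clifford_product m X Y"

lemma is_clifford_product: "is_clifford_product m (clifford_product m)"
  unfolding clifford_product_def using clifford_product_ex1[OF linear symmetric] by (rule theI')

lemma bilinear_prod: "bilinear (clifford_product m)"
  and prod_assoc: "(X \<diamondop> Y) \<diamondop> Z = X \<diamondop> (Y \<diamondop> Z)"
  and scalar_prod: "mv_scalar a \<diamondop> X = a *\<^sub>R X"
  and prod_scalar: "X \<diamondop> mv_scalar a = a *\<^sub>R X"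
  and vec_prod: "mv_vec b \<diamondop> X = lcontr (mv_vec (m b)) X + mv_vec b \<and>\<^sub>m X"
  and prod_vec: "X \<diamondop> mv_vec b = rcontr X (mv_vec (m b)) + X \<and>\<^sub>m mv_vec b"
  using is_clifford_product unfolding is_clifford_product_def by blast+

lemma linear_prod: "linear (clifford_product m X)" "linear (\<lambda>X. clifford_product m X Y)"
  using bilinear_prod unfolding bilinear_def by blast+

lemma vec_prod_grade_involution:
  "grade_involution (mv_vec b \<diamondop> X) = - (mv_vec b \<diamondop> grade_involution X)"
  by (simp add: vec_prod linear_add[OF linear_grade_involution] lcontr_grade_involution
      grade_involution_wedge grade_involution_mv_vec linear_neg[OF wedge_linear(2)])

text \<open>Left multiplication by vectors generates the algebra from 1. Associativity moves a new
  vector to the front of the product, where \<open>vec_prod_grade_involution\<close> handles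
  it.\<close>

lemma grade_involution_prod:
  "grade_involution (X \<diamondop> Y) = grade_involution X \<diamondop> grade_involution Y"
proof -
  let ?S = "{X. \<forall>Y. grade_involution (X \<diamondop> Y) = grade_involution X \<diamondop> grade_involution Y}"
  have "subspace ?S"
    unfolding subspace_def
    by (simp add: linear_0[OF linear_prod(2)] linear_add[OF linear_prod(2)]
        linear_scale[OF linear_prod(2)] linear_0[OF linear_grade_involution]
        linear_add[OF linear_grade_involution] linear_scale[OF linear_grade_involution])
  moreover have "mv_scalar 1 \<in> ?S" by (simp add: grade_involution_one scalar_prod)
  moreover have "clifford_left m b X \<in> ?S" if "X \<in> ?S" for b X
  proof -
    have "clifford_left m b X = mv_vec b \<diamondop> X" by (simp add: clifford_left_def vec_prod)
    then show ?thesis using that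
      by (simp add: prod_assoc vec_prod_grade_involution linear_neg[OF linear_prod(2)])
  qed
  ultimately show ?thesis using clifford_left_generates[of ?S m X] by simp
qed

text \<open>In \<open>grade_involution X \<diamondop> mv_vec b\<close> the wedge part is that of
  \<open>mv_vec b \<diamondop> X\<close> and the contraction part is its negative, so the sum
  isolates the wedge and the difference in \<open>lcontr_eq\<close> the contraction.\<close>

lemma vec_wedge_eq:
  "mv_vec b \<and>\<^sub>m X = (1/2) *\<^sub>R (mv_vec b \<diamondop> X + grade_involution X \<diamondop> mv_vec b)"
  by (simp add: vec_prod prod_vec rcontr_grade_involution lcontr_grade_involution
      grade_involution_involutive linear_neg[OF linear_grade_involution]
      wedge_vec_grade_involution[symmetric] scaleR_2[symmetric])

lemma lcontr_eq:
  "lcontr (mv_vec (m b)) X = (1/2) *\<^sub>R (mv_vec b \<diamondop> X - grade_involution X \<diamondop> mv_vec b)"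
  by (simp add: vec_prod prod_vec rcontr_grade_involution lcontr_grade_involution
      grade_involution_involutive linear_neg[OF linear_grade_involution]
      wedge_vec_grade_involution[symmetric] scaleR_2[symmetric])

lemma pseudoscalar_commute:
  "blade UNIV \<diamondop> mv_vec b = (-1) ^ (CARD('n) + 1) *\<^sub>R (mv_vec b \<diamondop> blade UNIV)"
proof -
  have I: "grade_involution (blade (UNIV :: 'n set)) = (-1) ^ CARD('n) *\<^sub>R blade UNIV"
    by (rule grade_involution_blade)
  \<comment> \<open>Both wedge parts vanish in top degree, so only the two contractions have to be
    compared.\<close>
  have "(-1) ^ CARD('n) *\<^sub>R (blade UNIV \<and>\<^sub>m mv_vec b) = 0"
    using wedge_vec_grade_involution[of b "blade UNIV"]
    by (simp add: I wedge_scaleR wedge_vec_pseudoscalar)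
  then have "blade UNIV \<and>\<^sub>m mv_vec b = 0" by simp
  moreover have "rcontr (blade UNIV) (mv_vec (m b)) = - lcontr (mv_vec (m b)) (grade_involution (blade UNIV))"
    by (simp add: rcontr_grade_involution lcontr_grade_involution)
  ultimately show ?thesis
    by (simp add: prod_vec vec_prod wedge_vec_pseudoscalar I linear_scale[OF linear_lcontr])
qed

text \<open>The pseudoscalar passes \<open>b\<close> with sign \<open>(-1) ^ (n + 1)\<close> and is
  itself of parity \<open>(-1) ^ n\<close>. These opposite signs turn the half sum of
  \<open>vec_wedge_eq\<close> into the half difference of \<open>lcontr_eq\<close>.\<close>

lemma pseudoscalar_prod_vec_wedge:
  "blade UNIV \<diamondop> (mv_vec b \<and>\<^sub>m X) =
    (-1) ^ (CARD('n) + 1) *\<^sub>R lcontr (mv_vec (m b)) (blade UNIV \<diamondop> X)"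
proof -
  have "blade UNIV \<diamondop> (mv_vec b \<diamondop> X) = (-1) ^ (CARD('n) + 1) *\<^sub>R (mv_vec b \<diamondop> (blade UNIV \<diamondop> X))"
    unfolding prod_assoc[symmetric] pseudoscalar_commute
    by (simp add: linear_scale[OF linear_prod(2)] linear_neg[OF linear_prod(2)])
  moreover have "grade_involution (blade UNIV \<diamondop> X) \<diamondop> mv_vec b =
      (-1) ^ CARD('n) *\<^sub>R (blade UNIV \<diamondop> (grade_involution X \<diamondop> mv_vec b))"
    by (simp add: grade_involution_prod grade_involution_blade linear_scale[OF linear_prod(2)] prod_assoc)
  ultimately show ?thesis
    by (simp add: vec_wedge_eq lcontr_eq linear_scale[OF linear_prod(1)] linear_add[OF linear_prod(1)]
        algebra_simps power_mult_distrib[symmetric])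
qed

end

section \<open>Comparison of the Euclidean and the inverse-metric Clifford products\<close>

lemma metric_map_id: "metric_map id"
  by unfold_locales (simp_all add: linear_id)

lemma symmetric_nonsingular_inv:
  fixes f :: "'n::{finite,linorder} canonical \<Rightarrow> 'n canonical"
  assumes f: "linear f" and sym: "\<And>v w. f v \<bullet> w = v \<bullet> f w" and det: "det (matrix f) \<noteq> 0"
  shows "bij f" and "metric_map (inv f)"
proof -
  have inj: "inj f" using det_nz_iff_inj[OF f] det by simp
  then show bij: "bij f" using linear_injective_imp_surjective[OF f] by (simp add: bij_def)
  have fi: "f (inv f v) = v" for v using bij by (simp add: bij_is_surj surj_f_inv_f)
  show "metric_map (inv f)"
  proof (rule metric_map.intro)
    show "linear (inv f)" using f inj by (simp add: inj_linear_imp_inv_linear)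
    fix v w
    show "inv f v \<bullet> w = v \<bullet> inv f w"
      using sym[of "inv f v" "inv f w"] by (simp add: fi)
  qed
qed

lemma outermorphism_pseudoscalar_prod:
  fixes f :: "'n::{finite,linorder} canonical \<Rightarrow> 'n canonical"
  assumes f: "linear f" and sym: "\<And>v w. f v \<bullet> w = v \<bullet> f w" and det: "det (matrix f) \<noteq> 0"
  shows "outermorphism f (clifford_product id (blade UNIV) X) =
    det (matrix f) *\<^sub>R clifford_product (inv f) (blade UNIV) X"
proof -
  interpret e: metric_map "id :: 'n canonical \<Rightarrow> 'n canonical" by (rule metric_map_id)
  interpret i: metric_map "inv f" by (rule symmetric_nonsingular_inv[OF assms])
  have fi: "f (inv f v) = v" for v
    using symmetric_nonsingular_inv(1)[OF assms] by (simp add: bij_is_surj surj_f_inv_f)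
  have adj: "adjoint f = f" using sym by (intro adjoint_unique) (simp add: inner_commute)
  \<comment> \<open>As \<open>f\<close> is self-adjoint, contraction by \<open>b\<close> becomes
    contraction by \<open>inv f b\<close> outside the outermorphism, which is the contraction in the
    recursion for the \<open>inv f\<close>-product.\<close>
  have *: "outermorphism f (lcontr (mv_vec b) Y) = lcontr (mv_vec (inv f b)) (outermorphism f Y)" for b Y
    by (simp add: lcontr_outermorphism[OF f] adj fi)
  show ?thesis
  proof (induction X rule: linear_eq_vec_wedge_induct[OF
        linear_compose[OF e.linear_prod(1) linear_outermorphism, unfolded o_def]
        linear_compose[OF i.linear_prod(1) linear_scaleR, unfolded o_def]])
    \<comment> \<open>The determinant enters here, as the factor by which the outermorphism scales
      the pseudoscalar.\<close>
    case 1 show ?case by (simp add: e.prod_scalar i.prod_scalar outermorphism_pseudoscalar)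
  next
    case (2 b X)
    then show ?case
      by (simp add: e.pseudoscalar_prod_vec_wedge[simplified] i.pseudoscalar_prod_vec_wedge *
          linear_scale[OF linear_outermorphism] linear_scale[OF linear_lcontr]
          linear_neg[OF linear_outermorphism])
  qed
qed

section \<open>Standard volume fields\<close>

lemma smooth_on_differentiable:
  assumes "smooth_on S f" "x \<in> S"
  shows "f differentiable (at x)"
proof -
  have "times_differentiable_on (Suc 0) S f" using assms(1) unfolding smooth_on_def by blast
  then show ?thesis using assms(2) by simp
qed

lemma smooth_on_continuous:
  assumes "smooth_on S f"
  shows "continuous_on S f"
proof -
  have "times_differentiable_on 0 S f" using assms unfolding smooth_on_def by blast
  then show ?thesis by simp
qed

lemma continuous_on_det:
  fixes A :: "'a::topological_space \<Rightarrow> real^'n^'n"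
  assumes "continuous_on S A"
  shows "continuous_on S (\<lambda>x. det (A x))"
  unfolding det_def by (intro continuous_intros assms)

lemma det_reciprocal_frames:
  fixes e e' :: "'n::{finite,linorder} \<Rightarrow> 'n canonical"
  assumes "\<And>\<mu> \<nu>. e \<mu> \<bullet> e' \<nu> = (if \<mu> = \<nu> then 1 else 0)"
  shows "det (\<chi> i. e i) * det (\<chi> i. e' i) = 1"
proof -
  have "(\<chi> i. e i) ** Finite_Cartesian_Product.transpose (\<chi> i. e' i) = mat 1"
    using assms by (simp add: matrix_matrix_mult_def Finite_Cartesian_Product.transpose_def
        inner_vec_def mat_def vec_eq_iff)
  then have "det ((\<chi> i. e i) ** Finite_Cartesian_Product.transpose (\<chi> i. e' i)) = 1" by simp
  then show ?thesis by (simp add: det_mul det_transpose)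
qed

text \<open>The square root is the absolute value of the determinant of \<open>e\<close>, the
  reciprocal of that of \<open>e'\<close>, so only the sign of the latter survives.\<close>

lemma volume_of_reciprocal_frames:
  fixes e e' :: "'n::{finite,linorder} \<Rightarrow> 'n canonical"
  assumes "\<And>\<mu> \<nu>. e \<mu> \<bullet> e' \<nu> = (if \<mu> = \<nu> then 1 else 0)"
  shows "sqrt (wedge_family e UNIV \<bullet> wedge_family e UNIV) *\<^sub>R wedge_family e' UNIV =
      sgn (det (\<chi> i. e' i)) *\<^sub>R blade UNIV"
proof -
  note d = det_reciprocal_frames[OF assms]
  have "wedge_family e UNIV \<bullet> wedge_family e UNIV = (det (\<chi> i. e i))\<^sup>2"
    by (simp add: wedge_family_UNIV inner_blade power2_eq_square) (simp add: blade_def)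
  moreover have "\<bar>det (\<chi> i. e i)\<bar> * det (\<chi> i. e' i) = sgn (det (\<chi> i. e' i))"
  proof -
    have "\<bar>det (\<chi> i. e i)\<bar> * \<bar>det (\<chi> i. e' i)\<bar> = 1" unfolding abs_mult[symmetric] d by simp
    then show ?thesis by (cases "0 < det (\<chi> i. e' i)") (auto simp: sgn_if)
  qed
  ultimately show ?thesis by (simp add: wedge_family_UNIV)
qed

text \<open>The determinant of the reciprocal frame is continuous and nowhere zero, so its sign is
  constant near each point. The claim is local because the sign may differ between components of
  \<open>U\<close>.\<close>

lemma standard_volume_field_locally_constant:
  fixes A :: "('p, 'n::{finite,linorder}) chart set"
  assumes "standard_volume_field A U \<tau>" and c: "(W, \<psi>) \<in> A" and "U \<subseteq> W"
    and inj: "inj_on \<psi> W" and op: "open (\<psi> ` U)" and p: "p \<in> U"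
  obtains s T where "open T" "\<psi> p \<in> T" "T \<subseteq> \<psi> ` U" "\<And>x. x \<in> T \<Longrightarrow> \<tau> (inv_into W \<psi> x) = s *\<^sub>R blade UNIV"
proof -
  obtain e e' where e: "reciprocal_frame_fields A U e e'" and \<tau>:
    "\<And>p. p \<in> U \<Longrightarrow> \<tau> p = sqrt (wedge_family (\<lambda>\<mu>. e \<mu> p) UNIV \<bullet> wedge_family (\<lambda>\<mu>. e \<mu> p) UNIV) *\<^sub>R
            wedge_family (\<lambda>\<mu>. e' \<mu> p) UNIV"
    using assms(1) unfolding standard_volume_field_def by auto
  define d where "d q = det (\<chi> i. e' i q)" for q
  have \<tau>d: "\<tau> q = sgn (d q) *\<^sub>R blade UNIV" and d0: "d q \<noteq> 0" if "q \<in> U" for q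
  proof -
    have "\<And>\<mu> \<nu>. e \<mu> q \<bullet> e' \<nu> q = (if \<mu> = \<nu> then 1 else 0)"
      using e that unfolding reciprocal_frame_fields_def by blast
    note volume_of_reciprocal_frames[OF this] det_reciprocal_frames[OF this]
    then show "\<tau> q = sgn (d q) *\<^sub>R blade UNIV" "d q \<noteq> 0" using \<tau>[OF that] by (auto simp: d_def)
  qed
  have WU: "W \<inter> U = U" using assms(3) by auto
  have "continuous_on (\<psi> ` U) (e' i \<circ> inv_into W \<psi>)" for i
  proof -
    have "smooth_field A U (e' i)" using e unfolding reciprocal_frame_fields_def by blast
    then have "smooth_on (\<psi> ` (W \<inter> U)) (e' i \<circ> inv_into W \<psi>)" using c unfolding smooth_field_def by auto
    then show ?thesis using smooth_on_continuous WU by metis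
  qed
  then have cont: "continuous_on (\<psi> ` U) (\<lambda>x. d (inv_into W \<psi> x))"
    unfolding d_def o_def by (intro continuous_on_det continuous_on_vec_lambda)
  have ip: "inv_into W \<psi> (\<psi> q) = q" if "q \<in> U" for q using inj that assms(3) by (auto intro: inv_into_f_f)
  \<comment> \<open>The coordinates of points where the determinant has the same sign as at
    \<open>p\<close>.\<close>
  define T where "T = {x \<in> \<psi> ` U. 0 < d (inv_into W \<psi> x) * d p}"
  have "T = \<psi> ` U \<inter> (\<lambda>x. d (inv_into W \<psi> x) * d p) -` {0<..}" by (auto simp: T_def)
  moreover have "open (\<psi> ` U \<inter> (\<lambda>x. d (inv_into W \<psi> x) * d p) -` {0<..})"
    using op by (intro continuous_open_preimage continuous_intros cont) auto
  ultimately have "open T" by simp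
  moreover have "\<psi> p \<in> T" using p d0[OF p] ip[OF p]
    by (auto simp: T_def power2_eq_square[symmetric] zero_less_mult_iff)
  moreover have "\<tau> (inv_into W \<psi> x) = sgn (d p) *\<^sub>R blade UNIV" if "x \<in> T" for x
    using that ip \<tau>d by (auto simp: T_def sgn_if zero_less_mult_iff)
  ultimately show thesis using that[of T "sgn (d p)"] by (auto simp: T_def)
qed

section \<open>Open chart images and differentiation of products with the volume field\<close>

lemma smooth_manifold_chart_open_image:
  fixes M :: "'p topology"
  assumes "smooth_manifold M A" "(W, \<psi>) \<in> A" "openin M U" "U \<subseteq> W"
  shows "inj_on \<psi> W" and "open (\<psi> ` U)"
proof -
  have "is_chart M (W, \<psi>)" using assms(1,2) unfolding smooth_manifold_def by blast
  then have W: "openin M W" "open (\<psi> ` W)"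
    and h: "homeomorphic_map (subtopology M W) (top_of_set (\<psi> ` W)) \<psi>" by auto
  have "topspace (subtopology M W) = W" using openin_subset[OF W(1)] by auto
  then show "inj_on \<psi> W" using homeomorphic_imp_injective_map[OF h] by simp
  have "openin (subtopology M W) U" using assms(3,4) by (metis inf.absorb1 openin_subtopology)
  then have "openin (top_of_set (\<psi> ` W)) (\<psi> ` U)"
    using homeomorphic_imp_open_map[OF h] unfolding open_map_def by blast
  then show "open (\<psi> ` U)" using W(2) openin_open_eq by blast
qed

text \<open>Near \<open>p\<close> the first factor is the constant \<open>\<tau> p\<close>, and a
  linear map on a finite-dimensional space is bounded, so it commutes with the derivative.\<close>

lemma coord_deriv_volume_prod:
  fixes A :: "('p, 'n::{finite,linorder}) chart set" and P :: "'n multivector \<Rightarrow> 'n multivector \<Rightarrow> 'n multivector"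
  assumes "standard_volume_field A U \<tau>" and c: "(W, \<psi>) \<in> A" and UW: "U \<subseteq> W"
    and inj: "inj_on \<psi> W" and op: "open (\<psi> ` U)" and p: "p \<in> U"
    and X: "smooth_field A U X" and lin: "linear (P (\<tau> p))"
  shows "coord_deriv (W, \<psi>) \<mu> (\<lambda>q. P (\<tau> q) (X q)) p = P (\<tau> p) (coord_deriv (W, \<psi>) \<mu> X p)"
proof -
  obtain s T where T: "open T" "\<psi> p \<in> T" "T \<subseteq> \<psi> ` U"
    and s: "\<And>x. x \<in> T \<Longrightarrow> \<tau> (inv_into W \<psi> x) = s *\<^sub>R blade UNIV"
    using standard_volume_field_locally_constant[OF assms(1-6)] by metis
  have "inv_into W \<psi> (\<psi> p) = p" using inj p UW by (auto intro: inv_into_f_f)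
  then have \<tau>: "\<tau> (inv_into W \<psi> x) = \<tau> p" if "x \<in> T" for x using s[OF that] s[OF T(2)] by simp
  have "W \<inter> U = U" using UW by auto
  then have "smooth_on (\<psi> ` U) (X \<circ> inv_into W \<psi>)" using X c unfolding smooth_field_def by force
  then have "(X \<circ> inv_into W \<psi>) differentiable (at (\<psi> p))"
    using p by (intro smooth_on_differentiable) auto
  then have D: "((X \<circ> inv_into W \<psi>) has_derivative frechet_derivative (X \<circ> inv_into W \<psi>) (at (\<psi> p))) (at (\<psi> p))"
    by (simp add: frechet_derivative_works)
  have "bounded_linear (P (\<tau> p))" using lin by (rule linear_conv_bounded_linear[THEN iffD1])
  from bounded_linear.has_derivative[OF this D]
  have "((\<lambda>q. P (\<tau> q) (X q)) \<circ> inv_into W \<psi> has_derivative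
      (\<lambda>h. P (\<tau> p) (frechet_derivative (X \<circ> inv_into W \<psi>) (at (\<psi> p)) h))) (at (\<psi> p))"
    by (rule has_derivative_transform_within_open[OF _ T(1,2)]) (simp add: \<tau>)
  from fun_cong[OF frechet_derivative_at[OF this], of "axis \<mu> 1"] show ?thesis by simp
qed

theorem mainTheorem14:
  fixes M :: "'p topology"
    and A :: "('p, 'n::{finite,linorder}) chart set"
    and U\<^sub>o U :: "'p set"
    and \<phi>\<^sub>o :: "'p \<Rightarrow> 'n canonical"
    and g :: "'p \<Rightarrow> 'n canonical \<Rightarrow>\<^sub>L 'n canonical"
    and \<tau> X :: "'p \<Rightarrow> 'n multivector"
  assumes "smooth_manifold M A" and "(U\<^sub>o, \<phi>\<^sub>o) \<in> A" and "openin M U" and "U \<subseteq> U\<^sub>o"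
    and "metric_structure A U g"
    and "standard_volume_field A U \<tau>"
    and "X \<in> multivector_fields A U"
  shows "(\<forall>p\<in>U. clifford_product id (\<tau> p) (curl_deriv (U\<^sub>o, \<phi>\<^sub>o) X p) =
      (-1) ^ (CARD('n) + 1) *\<^sub>R
        div_deriv (U\<^sub>o, \<phi>\<^sub>o) (\<lambda>q. clifford_product id (\<tau> q) (X q)) p) \<and>
    (\<forall>p\<in>U. clifford_product (inv (g p)) (\<tau> p) (curl_deriv (U\<^sub>o, \<phi>\<^sub>o) X p) =
      ((-1) ^ (CARD('n) + 1) / det (matrix (g p))) *\<^sub>R
        outermorphism (g p) (div_deriv (U\<^sub>o, \<phi>\<^sub>o) (\<lambda>q. clifford_product id (\<tau> q) (X q)) p))"
proof -
  interpret e: metric_map "id :: 'n canonical \<Rightarrow> 'n canonical" by (rule metric_map_id)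
  note chart = smooth_manifold_chart_open_image[OF assms(1-4)]
  have X: "smooth_field A U X" using assms(7) by (simp add: multivector_fields_def)
  have pseudoscalar: "\<exists>s. \<tau> p = s *\<^sub>R blade UNIV" if p: "p \<in> U" for p
  proof -
    have "inv_into U\<^sub>o \<phi>\<^sub>o (\<phi>\<^sub>o p) = p" using chart(1) p assms(4) by (auto intro: inv_into_f_f)
    then show ?thesis
      using standard_volume_field_locally_constant[OF assms(6,2,4) chart p] by metis
  qed
  have 1: "clifford_product id (\<tau> p) (curl_deriv (U\<^sub>o, \<phi>\<^sub>o) X p) = (-1) ^ (CARD('n) + 1) *\<^sub>R
        div_deriv (U\<^sub>o, \<phi>\<^sub>o) (\<lambda>q. clifford_product id (\<tau> q) (X q)) p" if p: "p \<in> U" for p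
  proof -
    obtain s where s: "\<tau> p = s *\<^sub>R blade UNIV" using pseudoscalar[OF p] by blast
    \<comment> \<open>The identity for each summand: \<open>\<tau> p\<close> is a multiple of the
      pseudoscalar, and both sides are linear in it.\<close>
    have "clifford_product id (\<tau> p) (mv_vec b \<and>\<^sub>m Y) =
        (-1) ^ (CARD('n) + 1) *\<^sub>R lcontr (mv_vec b) (clifford_product id (\<tau> p) Y)" for b Y
      using e.pseudoscalar_prod_vec_wedge[of b Y]
      by (simp add: s linear_scale[OF e.linear_prod(2)] linear_scale[OF linear_lcontr])
    then show ?thesis
      unfolding curl_deriv_def div_deriv_def
        coord_deriv_volume_prod[where P="clifford_product id", OF assms(6,2,4) chart p X e.linear_prod(1)]
      by (simp add: linear_sum[OF e.linear_prod(1)] scaleR_sum_right sum_negf del: coord_deriv.simps)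
  qed
  have 2: "clifford_product (inv (g p)) (\<tau> p) (curl_deriv (U\<^sub>o, \<phi>\<^sub>o) X p) =
      ((-1) ^ (CARD('n) + 1) / det (matrix (g p))) *\<^sub>R
        outermorphism (g p) (div_deriv (U\<^sub>o, \<phi>\<^sub>o) (\<lambda>q. clifford_product id (\<tau> q) (X q)) p)"
    if p: "p \<in> U" for p
  proof -
    have lin: "linear (g p)" by (simp add: bounded_linear.linear blinfun.bounded_linear_right)
    have sym: "\<And>v w. g p v \<bullet> w = v \<bullet> g p w" and det: "det (matrix (g p)) \<noteq> 0"
      using assms(5) p unfolding metric_structure_def by blast+
    interpret i: metric_map "inv (g p)" by (rule symmetric_nonsingular_inv[OF lin sym det])
    obtain s where s: "\<tau> p = s *\<^sub>R blade UNIV" using pseudoscalar[OF p] by blast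
    have "outermorphism (g p) (clifford_product id (\<tau> p) Y) =
        det (matrix (g p)) *\<^sub>R clifford_product (inv (g p)) (\<tau> p) Y" for Y
      using outermorphism_pseudoscalar_prod[OF lin sym det, of Y]
      by (simp add: s linear_scale[OF e.linear_prod(2)] linear_scale[OF i.linear_prod(2)]
          linear_scale[OF linear_outermorphism])
    then have eq: "clifford_product (inv (g p)) (\<tau> p) Y =
        (1 / det (matrix (g p))) *\<^sub>R outermorphism (g p) (clifford_product id (\<tau> p) Y)" for Y
      using det by simp
    \<comment> \<open>\<open>eq\<close> rewrites the product on the left as an outermorphism of the
      Euclidean product, to which the first formula applies.\<close>
    show ?thesis unfolding eq 1[OF p] by (simp add: linear_scale[OF linear_outermorphism] del: power_Suc)
  qed
  show ?thesis using 1 2 by blast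
qed

end
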